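(* Let $A$ be an approximately unital Banach algebra. The class of $M$-ideal ideals in $A$ forms a lattice: the intersection of finitely many $M$-ideal ideals, and the closure of the sum (linear span) of any collection of $M$-ideal ideals, are again $M$-ideal ideals. The correspondence $J\mapsto s_J$ between $M$-ideal ideals of $A$ and their support projections (which lie in $\Delta'\subset A^{**}$) is a bijection onto the set of such support projections, satisfies $J_1\subseteq J_2$ iff $s_{J_1}\le s_{J_2}$, and preserves finite meets and arbitrary joins: $s_{J_1\cap J_2}=s_{J_1}s_{J_2}$ for $M$-ideal ideals $J_1,J_2$, and if $\{J_i:i\in I\}$ is any collection of $M$-ideal ideals and $J$ is the closure of their span, then $s_J$ is the supremum in $\Delta'$ of $\{s_{J_i}:i\in I\}$.
   Context: Banach algebras are complex with submultiplicative norm; "unital" means identity of norm 1; approximately unital means having a contractive approximate identity. The multiplier unitization $A^1$ is $A$ if $A$ is unital, otherwise $A+\mathbb{C}1$ with $\|a+\lambda1\|=\sup\{\|ac+\lambda c\|:c\in A,\|c\|\le1\}$. Biduals carry the second Arens product; $A^{**}\cong A^{\perp\perp}\subset N:=(A^1)^{**}$. An $M$-projection on a Banach space $Y$ is a projection $P$ with $\|y\|=\max\{\|Py\|,\|y-Py\|\}$ for all $y$. A subspace $J$ of a Banach space $X$ is an $M$-ideal if $J^{\perp\perp}$ is the range of an $M$-projection $P$ on $X^{**}$ (then $P$ is unique). An $M$-ideal ideal in $A$ is a subspace $J\subset A$ which is an $M$-ideal in $A^1$ such that, with $P$ the $M$-projection of $N$ onto $J^{\perp\perp}$, the element $z=P(1)$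 commutes with every element of $A^{**}$; such $J$ is a closed two-sided ideal, $z$ is an idempotent in $J^{\perp\perp}\subset A^{**}$, called the support projection $s_J$ of $J$, and $J=s_JA^{**}\cap A$. For projections $p,q$ here, $p\le q$ means $pq=qp=p$. Let $Z(N)$ be the centralizer of the dual space $N$, i.e. the norm-closed span of the $M$-projections on $N$; it is a commutative $W^*$-algebra, and $T\mapsto T(1)$ identifies it (isometrically, weak*-homeomorphically, as algebras) with a weak*-closed commutative $W^*$-subalgebra $\Delta$ of $N$. Let $\Delta'$ be the weak* closure in $\Delta$ of the span of those projections of $\Delta$ lying in $A^{**}$; it is a commutative $W^*$-algebra, and suprema of projections are taken in it. *)

theory Defs
  imports "HOL-Analysis.Analysis"
begin

class complex_banach_algebra = real_normed_algebra + banach +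
  fixes scaleC :: "complex \<Rightarrow> 'a \<Rightarrow> 'a"
  assumes scaleC_add_right: "scaleC c (x + y) = scaleC c x + scaleC c y"
    and scaleC_add_left: "scaleC (c + d) x = scaleC c x + scaleC d x"
    and scaleC_scaleC: "scaleC c (scaleC d x) = scaleC (c * d) x"
    and scaleC_one: "scaleC 1 x = x"
    and scaleC_of_real: "scaleC (complex_of_real r) x = scaleR r x"
    and norm_scaleC: "norm (scaleC c x) = cmod c * norm x"
    and scaleC_mult_left: "scaleC c (x * y) = scaleC c x * y"
    and scaleC_mult_right: "scaleC c (x * y) = x * scaleC c y"

definition csubspace :: "'a::complex_banach_algebra set \<Rightarrow> bool" where
  "csubspace J \<longleftrightarrow> 0 \<in> J \<and> (\<forall>x\<in>J. \<forall>y\<in>J. x + y \<in> J) \<and> (\<forall>c. \<forall>x\<in>J. scaleC c x \<in> J)"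

definition cspan :: "'a::complex_banach_algebra set \<Rightarrow> 'a set" where
  "cspan S = {(\<Sum>x\<in>F. scaleC (c x) x) | F c. finite F \<and> F \<subseteq> S}"

text \<open>Approximately unital: there is a contractive approximate identity. A net of
contractions is encoded by the (proper) filter on A which it generates.\<close>
definition approx_unital :: "'a::complex_banach_algebra itself \<Rightarrow> bool" where
  "approx_unital _ \<longleftrightarrow> (\<exists>F::'a filter. F \<noteq> bot \<and> eventually (\<lambda>e. norm e \<le> 1) F \<and>
      (\<forall>a. ((\<lambda>e. e * a) \<longlongrightarrow> a) F \<and> ((\<lambda>e. a * e) \<longlongrightarrow> a) F))"

text \<open>Elements of A^1 are represented by pairs (a, lambda) meaning a + lambda 1, with the
multiplier seminorm; A^1 is the quotient by its null space (which is trivial if A is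
non-unital and approximately unital, and which identifies A + C1 with A if A is unital).
All functionals below are bounded w.r.t. this seminorm, so they live on the quotient.\<close>

type_synonym 'a unit_el = "'a \<times> complex"

definition uadd :: "'a::complex_banach_algebra unit_el \<Rightarrow> 'a unit_el \<Rightarrow> 'a unit_el" where
  "uadd x y = (fst x + fst y, snd x + snd y)"

definition uscale :: "complex \<Rightarrow> 'a::complex_banach_algebra unit_el \<Rightarrow> 'a unit_el" where
  "uscale c x = (scaleC c (fst x), c * snd x)"

definition umult :: "'a::complex_banach_algebra unit_el \<Rightarrow> 'a unit_el \<Rightarrow> 'a unit_el" where
  "umult x y = (fst x * fst y + scaleC (snd x) (fst y) + scaleC (snd y) (fst x), snd x * snd y)"

definition unorm :: "'a::complex_banach_algebra unit_el \<Rightarrow> real" where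
  "unorm x = (SUP c\<in>{c::'a. norm c \<le> 1}. norm (fst x * c + scaleC (snd x) c))"

definition inA :: "'a::complex_banach_algebra \<Rightarrow> 'a unit_el" where
  "inA a = (a, 0)"

type_synonym 'a dual_el = "'a unit_el \<Rightarrow> complex"
type_synonym 'a bidual_el = "'a dual_el \<Rightarrow> complex"

definition udual :: "'a::complex_banach_algebra dual_el set" where
  "udual = {\<phi>. (\<forall>x y. \<phi> (uadd x y) = \<phi> x + \<phi> y) \<and> (\<forall>c x. \<phi> (uscale c x) = c * \<phi> x) \<and>
              (\<exists>K. \<forall>x. cmod (\<phi> x) \<le> K * unorm x)}"

definition dnorm :: "'a::complex_banach_algebra dual_el \<Rightarrow> real" where
  "dnorm \<phi> = (SUP x\<in>{x. unorm x \<le> 1}. cmod (\<phi> x))"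

definition Nsp :: "'a::complex_banach_algebra bidual_el set" where
  "Nsp = {\<Phi>. (\<forall>\<phi>\<in>udual. \<forall>\<psi>\<in>udual. \<Phi> (\<lambda>x. \<phi> x + \<psi> x) = \<Phi> \<phi> + \<Phi> \<psi>) \<and>
             (\<forall>\<phi>\<in>udual. \<forall>c. \<Phi> (\<lambda>x. c * \<phi> x) = c * \<Phi> \<phi>) \<and>
             (\<exists>K. \<forall>\<phi>\<in>udual. cmod (\<Phi> \<phi>) \<le> K * dnorm \<phi>) \<and>
             (\<forall>\<phi>. \<phi> \<notin> udual \<longrightarrow> \<Phi> \<phi> = 0)}"

definition bnorm :: "'a::complex_banach_algebra bidual_el \<Rightarrow> real" where
  "bnorm \<Phi> = (SUP \<phi>\<in>{\<phi>\<in>udual. dnorm \<phi> \<le> 1}. cmod (\<Phi> \<phi>))"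

definition badd :: "'a::complex_banach_algebra bidual_el \<Rightarrow> 'a bidual_el \<Rightarrow> 'a bidual_el" where
  "badd \<Phi> \<Psi> = (\<lambda>\<phi>. \<Phi> \<phi> + \<Psi> \<phi>)"

definition bscale :: "complex \<Rightarrow> 'a::complex_banach_algebra bidual_el \<Rightarrow> 'a bidual_el" where
  "bscale c \<Phi> = (\<lambda>\<phi>. c * \<Phi> \<phi>)"

definition emb :: "'a::complex_banach_algebra unit_el \<Rightarrow> 'a bidual_el" where
  "emb x = (\<lambda>\<phi>. if \<phi> \<in> udual then \<phi> x else 0)"

definition oneN :: "'a::complex_banach_algebra bidual_el" where
  "oneN = emb (0, 1)"

text \<open>Second Arens product: <phi, F.G> = <phi.F, G>, where <x, phi.F> = <x.phi, F>
and <y, x.phi> = <y x, phi>.\<close>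
definition arens2 :: "'a::complex_banach_algebra bidual_el \<Rightarrow> 'a bidual_el \<Rightarrow> 'a bidual_el" where
  "arens2 \<Phi> \<Psi> = (\<lambda>\<phi>. if \<phi> \<in> udual then \<Psi> (\<lambda>x. \<Phi> (\<lambda>y. \<phi> (umult y x))) else 0)"

definition perp :: "'a::complex_banach_algebra unit_el set \<Rightarrow> 'a dual_el set" where
  "perp S = {\<phi>\<in>udual. \<forall>x\<in>S. \<phi> x = 0}"

definition perpperp :: "'a::complex_banach_algebra unit_el set \<Rightarrow> 'a bidual_el set" where
  "perpperp S = {\<Phi>\<in>Nsp. \<forall>\<phi>\<in>perp S. \<Phi> \<phi> = 0}"

definition Abidual :: "'a::complex_banach_algebra bidual_el set" where
  "Abidual = perpperp (range inA)"

definition is_Mproj :: "('a::complex_banach_algebra bidual_el \<Rightarrow> 'a bidual_el) \<Rightarrow> bool" where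
  "is_Mproj P \<longleftrightarrow> (\<forall>\<Phi>\<in>Nsp. P \<Phi> \<in> Nsp) \<and>
     (\<forall>\<Phi>\<in>Nsp. \<forall>\<Psi>\<in>Nsp. P (badd \<Phi> \<Psi>) = badd (P \<Phi>) (P \<Psi>)) \<and>
     (\<forall>\<Phi>\<in>Nsp. \<forall>c. P (bscale c \<Phi>) = bscale c (P \<Phi>)) \<and>
     (\<forall>\<Phi>\<in>Nsp. P (P \<Phi>) = P \<Phi>) \<and>
     (\<forall>\<Phi>\<in>Nsp. bnorm \<Phi> = max (bnorm (P \<Phi>)) (bnorm (badd \<Phi> (bscale (-1) (P \<Phi>)))))"

definition is_MII :: "'a::complex_banach_algebra set \<Rightarrow> bool" where
  "is_MII J \<longleftrightarrow> csubspace J \<and> closed J \<and>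
     (\<exists>P. is_Mproj P \<and> P ` Nsp = perpperp (inA ` J) \<and>
          (\<forall>\<Phi>\<in>Abidual. arens2 (P oneN) \<Phi> = arens2 \<Phi> (P oneN)))"

definition supp :: "'a::complex_banach_algebra set \<Rightarrow> 'a bidual_el" where
  "supp J = (THE z. \<exists>P. is_Mproj P \<and> P ` Nsp = perpperp (inA ` J) \<and> z = P oneN)"

definition Mspan :: "('a::complex_banach_algebra bidual_el \<Rightarrow> 'a bidual_el) set" where
  "Mspan = {(\<lambda>\<Phi> \<phi>. \<Sum>P\<in>F. c P * P \<Phi> \<phi>) | F c. finite F \<and> F \<subseteq> {P. is_Mproj P}}"

definition centralizer :: "('a::complex_banach_algebra bidual_el \<Rightarrow> 'a bidual_el) set" where
  "centralizer = {T. (\<forall>\<Phi>\<in>Nsp. T \<Phi> \<in> Nsp) \<and>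
     (\<forall>\<epsilon>>0. \<exists>S\<in>Mspan. \<forall>\<Phi>\<in>Nsp. bnorm (badd (T \<Phi>) (bscale (-1) (S \<Phi>))) \<le> \<epsilon> * bnorm \<Phi>)}"

definition Delta :: "'a::complex_banach_algebra bidual_el set" where
  "Delta = (\<lambda>T. T oneN) ` centralizer"

definition is_proj :: "'a::complex_banach_algebra bidual_el \<Rightarrow> bool" where
  "is_proj p \<longleftrightarrow> p \<in> Nsp \<and> arens2 p p = p"

definition proj_le :: "'a::complex_banach_algebra bidual_el \<Rightarrow> 'a bidual_el \<Rightarrow> bool" where
  "proj_le p q \<longleftrightarrow> arens2 p q = p \<and> arens2 q p = p"

definition Nspan :: "'a::complex_banach_algebra bidual_el set \<Rightarrow> 'a bidual_el set" where
  "Nspan S = {(\<lambda>\<phi>. \<Sum>\<Psi>\<in>F. c \<Psi> * \<Psi> \<phi>) | F c. finite F \<and> F \<subseteq> S}"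

definition wstar_closure :: "'a::complex_banach_algebra bidual_el set \<Rightarrow> 'a bidual_el set" where
  "wstar_closure S = {\<Phi>\<in>Nsp. \<forall>F \<epsilon>. finite F \<and> F \<subseteq> udual \<and> \<epsilon> > 0 \<longrightarrow>
       (\<exists>\<Psi>\<in>S. \<forall>\<phi>\<in>F. cmod (\<Phi> \<phi> - \<Psi> \<phi>) < \<epsilon>)}"

definition Delta' :: "'a::complex_banach_algebra bidual_el set" where
  "Delta' = Delta \<inter> wstar_closure (Nspan {p\<in>Delta. is_proj p \<and> p \<in> Abidual})"

definition is_proj_sup :: "'a::complex_banach_algebra bidual_el set \<Rightarrow> 'a bidual_el set \<Rightarrow> 'a bidual_el \<Rightarrow> bool" where
  "is_proj_sup D S p \<longleftrightarrow> p \<in> D \<and> is_proj p \<and> (\<forall>s\<in>S. proj_le s p) \<and>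
     (\<forall>q\<in>D. is_proj q \<and> (\<forall>s\<in>S. proj_le s q) \<longrightarrow> proj_le p q)"

end

theory Submission
  imports Defs
begin

text \<open>The obstacle is that the second Arens product is weak*-continuous in its right factor
  only. For a weak* limit \<open>z\<close> of central idempotents \<open>u\<close>, the products
  \<open>\<Psi> * u\<close> tend to \<open>\<Psi> * z\<close>, but nothing forces
  \<open>u * \<Psi>\<close> to tend to \<open>z * \<Psi>\<close>. Uniform convergence on the unit
  ball supplies this, and then \<open>z\<close> commutes and inherits its properties from both
  sides. The condition on \<open>1 + (\<mu> - 1)T\<close> is chosen because M-projections and left
  multiplication by \<open>w\<close> both meet it: one commutation result yields uniqueness of
  \<open>P\<close> for a given range as well as idempotence of \<open>z\<close>. The definition asks
  \<open>z\<close> to commute with the bidual of \<open>A\<close> only; since \<open>N\<close> is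
  that bidual plus the multiples of 1, \<open>z\<close> is central in \<open>N\<close>. Approximate
  unitality makes the seminorm of the unitization agree with the norm on \<open>A\<close>.
  Hahn--Banach then recovers a closed \<open>J\<close> from
  \<open>J\<^sup>\<bottom>\<^sup>\<bottom>\<close>, and both the ideal property and the order
  correspondence rest on this.\<close>

text \<open>An M-projection \<open>P\<close> commutes with every operator \<open>T\<close> for which all \<open>1 + (\<mu> - 1)T\<close>,
\<open>|\<mu>| = 1\<close>, are contractive. Put \<open>z = P(1)\<close> and \<open>w = 1 - z\<close> in the bidual \<open>N\<close>. Left multiplication
by \<open>w\<close> is such an operator, so \<open>wz = wP(1) = P(w) = 0\<close> and \<open>z\<close> is idempotent. If \<open>z\<close> is central, then
\<open>v = wP(x)\<close> is fixed by \<open>P\<close> and \<open>P(w) = 0\<close>, so \<open>\<parallel>w \<plusminus> v\<parallel> \<le> 1\<close> after scaling \<open>v\<close> to norm one,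
whereas \<open>4v = (w + v)\<^sup>2 - (w - v)\<^sup>2\<close> has norm at most two; hence \<open>v = 0\<close> and \<open>P\<close> is
multiplication by \<open>z\<close>. M-ideal ideals thus correspond to central idempotents \<open>z\<close> with
\<open>zN = J\<^sup>\<bottom>\<^sup>\<bottom>\<close>. Intersections correspond to products because \<open>J\<^sub>1J\<^sub>2 \<subseteq> J\<^sub>1 \<inter> J\<^sub>2\<close>, and
closed spans to weak* limits of finite joins. The maximum norm condition makes \<open>(u\<Phi>)(\<phi>)\<close>
converge uniformly in \<open>\<parallel>\<Phi>\<parallel> \<le> 1\<close> along these joins \<open>u\<close>, so the limit is again central.\<close>

section \<open>Sublinear functionals\<close>

definition sublinear :: "('v::real_vector \<Rightarrow> real) \<Rightarrow> bool" where
  "sublinear p \<longleftrightarrow> (\<forall>x y. p (x + y) \<le> p x + p y) \<and> (\<forall>r x. 0 \<le> r \<longrightarrow> p (r *\<^sub>R x) = r * p x)"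

text \<open>The scaling inequality at 1/r is the reverse inequality at r. Functionals defined as
  infima give one direction directly.\<close>

lemma sublinearI:
  assumes "\<And>x y. p (x + y) \<le> p x + p y" and "p 0 = 0"
    and le: "\<And>r x. 0 < r \<Longrightarrow> p (r *\<^sub>R x) \<le> r * p x"
  shows "sublinear p"
  unfolding sublinear_def
proof (intro conjI allI impI)
  fix r :: real and x
  assume "0 \<le> r"
  show "p (r *\<^sub>R x) = r * p x"
  proof (cases "r = 0")
    case False
    with \<open>0 \<le> r\<close> have r: "r > 0" by simp
    have "p ((1/r) *\<^sub>R (r *\<^sub>R x)) \<le> (1/r) * p (r *\<^sub>R x)"
      using r by (intro le) simp
    with r have "r * p x \<le> p (r *\<^sub>R x)"
      by (simp add: field_simps)
    with le[OF r, of x] show ?thesis by simp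
  qed (simp add: assms)
qed (rule assms)

lemma sublinear_add: "sublinear p \<Longrightarrow> p (x + y) \<le> p x + p y"
  by (simp add: sublinear_def)

lemma sublinear_scale: "sublinear p \<Longrightarrow> 0 \<le> r \<Longrightarrow> p (r *\<^sub>R x) = r * p x"
  by (simp add: sublinear_def)

lemma sublinear_zero: "sublinear p \<Longrightarrow> p 0 = 0"
  using sublinear_scale[of p 0 0] by simp

lemma sublinear_minus: "sublinear p \<Longrightarrow> - p (- x) \<le> p x"
  using sublinear_add[of p x "- x"] by (simp add: sublinear_zero)

text \<open>Zorn for the reversed pointwise order. The pointwise infimum of a chain is finite
  because every sublinear q below p satisfies -p(-x) <= q(x).\<close>

lemma minimal_sublinear_exists:
  assumes p: "sublinear (p :: 'v::real_vector \<Rightarrow> real)"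
  shows "\<exists>q. sublinear q \<and> q \<le> p \<and> (\<forall>r. sublinear r \<and> r \<le> q \<longrightarrow> r = q)"
proof -
  define A where "A = {q. sublinear q \<and> q \<le> p}"
  have "\<exists>m\<in>A. \<forall>a\<in>A. a \<le> m \<longrightarrow> a = m"
  proof (rule predicate_Zorn)
    show "partial_order_on A (relation_of (\<lambda>x y. y \<le> x) A)"
      by (rule partial_order_on_relation_ofI) auto
  next
    fix C assume "C \<in> Chains (relation_of (\<lambda>x y. y \<le> x) A)"
    then have CA: "C \<subseteq> A" and tot: "\<And>f g. f \<in> C \<Longrightarrow> g \<in> C \<Longrightarrow> f \<le> g \<or> g \<le> f"
      unfolding Chains_def relation_of_def by auto
    show "\<exists>u\<in>A. \<forall>a\<in>C. u \<le> a"
    proof (cases "C = {}")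
      case True
      with p show ?thesis by (auto simp: A_def)
    next
      case False
      define u where "u x = (INF q\<in>C. q x)" for x
      have sub: "sublinear q" if "q \<in> C" for q using that CA by (auto simp: A_def)
      have lep: "q x \<le> p x" if "q \<in> C" for q x using that CA by (auto simp: A_def le_fun_def)
      have bdd: "bdd_below ((\<lambda>q. q x) ` C)" for x
      proof (rule bdd_belowI2)
        fix q assume q: "q \<in> C"
        show "- p (- x) \<le> q x"
          using sublinear_minus[OF sub[OF q], of x] lep[OF q, of "- x"] by linarith
      qed
      have u_le: "u x \<le> q x" if "q \<in> C" for q x
        unfolding u_def by (rule cINF_lower[OF bdd that])
      have u_ge: "b \<le> u x" if "\<And>q. q \<in> C \<Longrightarrow> b \<le> q x" for b x
        unfolding u_def by (rule cINF_greatest[OF False that])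
      have "sublinear u"
      proof (rule sublinearI)
        fix x y
        \<comment> \<open>The infima for x and y range over independent members of the chain; the
          smaller of two members serves both.\<close>
        have *: "u (x + y) \<le> f x + g y" if "f \<in> C" "g \<in> C" for f g
        proof -
          obtain q where q: "q \<in> C" "q \<le> f" "q \<le> g" using tot[OF \<open>f \<in> C\<close> \<open>g \<in> C\<close>] \<open>f \<in> C\<close> \<open>g \<in> C\<close> by blast
          have "u (x + y) \<le> q x + q y"
            using u_le[OF q(1)] sublinear_add[OF sub[OF q(1)]] by (meson order_trans)
          with q show ?thesis by (smt (verit) le_funD)
        qed
        have "u (x + y) - f x \<le> u y" if "f \<in> C" for f
          using *[OF that] by (intro u_ge) (simp add: algebra_simps)
        then have "u (x + y) - u y \<le> u x"
          by (intro u_ge) (simp add: algebra_simps)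
        then show "u (x + y) \<le> u x + u y" by simp
      next
        show "u 0 = 0" using False by (simp add: u_def sublinear_zero sub cong: INF_cong)
      next
        fix r :: real and x
        assume r: "0 < r"
        have "u (r *\<^sub>R x) / r \<le> u x"
        proof (rule u_ge)
          fix q assume q: "q \<in> C"
          have "u (r *\<^sub>R x) \<le> r * q x"
            using u_le[OF q, of "r *\<^sub>R x"] sublinear_scale[OF sub[OF q], of r x] r by simp
          then show "u (r *\<^sub>R x) / r \<le> q x" using r by (simp add: field_simps)
        qed
        then show "u (r *\<^sub>R x) \<le> r * u x" using r by (simp add: field_simps)
      qed
      moreover have "u \<le> p"
        using False u_le lep by (meson all_not_in_conv le_funI order_trans)
      ultimately show ?thesis using u_le by (auto simp: A_def le_fun_def)
    qed
  qed
  then show ?thesis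
    unfolding A_def using order_trans by blast
qed

text \<open>The Hahn--Banach minorant of \<open>p\<close> in direction \<open>y\<close>. It lies
  below \<open>p\<close>, and t = 1 shows that its value at -y is at most -p(y); a linear functional
  below it therefore takes the value p(y) at y.\<close>

definition tilt :: "('v::real_vector \<Rightarrow> real) \<Rightarrow> 'v \<Rightarrow> 'v \<Rightarrow> real" where
  "tilt p y x = (INF t\<in>{0..}. p (x + t *\<^sub>R y) - t * p y)"

lemma tilt_bdd_below:
  assumes "sublinear p"
  shows "bdd_below ((\<lambda>t. p (x + t *\<^sub>R y) - t * p y) ` {0..})"
proof (rule bdd_belowI2)
  fix t :: real assume "t \<in> {0..}"
  then show "- p (- x) \<le> p (x + t *\<^sub>R y) - t * p y"
    using sublinear_add[OF assms, of "x + t *\<^sub>R y" "- x"] sublinear_scale[OF assms, of t y] by simp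
qed

lemma tilt_le:
  assumes "sublinear p" "0 \<le> t"
  shows "tilt p y x \<le> p (x + t *\<^sub>R y) - t * p y"
  unfolding tilt_def by (rule cINF_lower[OF tilt_bdd_below]) (use assms in auto)

lemma tilt_ge: "(\<And>t. 0 \<le> t \<Longrightarrow> b \<le> p (x + t *\<^sub>R y) - t * p y) \<Longrightarrow> b \<le> tilt p y x"
  unfolding tilt_def by (rule cINF_greatest) auto

lemma sublinear_tilt:
  assumes p: "sublinear p"
  shows "sublinear (tilt p y)"
proof (rule sublinearI)
  fix x x'
  have *: "tilt p y (x + x') \<le> (p (x + t *\<^sub>R y) - t * p y) + (p (x' + t' *\<^sub>R y) - t' * p y)"
    if "0 \<le> t" "0 \<le> t'" for t t'
  proof -
    have "tilt p y (x + x') \<le> p (x + x' + (t + t') *\<^sub>R y) - (t + t') * p y"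
      using that by (intro tilt_le[OF p]) simp
    also have "x + x' + (t + t') *\<^sub>R y = (x + t *\<^sub>R y) + (x' + t' *\<^sub>R y)"
      by (simp add: algebra_simps)
    finally show ?thesis
      using sublinear_add[OF p, of "x + t *\<^sub>R y" "x' + t' *\<^sub>R y"] by (simp add: algebra_simps)
  qed
  have "tilt p y (x + x') - (p (x + t *\<^sub>R y) - t * p y) \<le> tilt p y x'" if "0 \<le> t" for t
    using *[OF that] by (intro tilt_ge) (simp add: algebra_simps)
  then have "tilt p y (x + x') - tilt p y x' \<le> tilt p y x"
    by (intro tilt_ge) (simp add: algebra_simps)
  then show "tilt p y (x + x') \<le> tilt p y x + tilt p y x'" by simp
next
  show "tilt p y 0 = 0"
  proof (rule antisym)
    show "tilt p y 0 \<le> 0" using tilt_le[OF p, of 0 y 0] by (simp add: sublinear_zero[OF p])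
    show "0 \<le> tilt p y 0" by (rule tilt_ge) (simp add: sublinear_scale[OF p])
  qed
next
  fix r :: real and x
  assume r: "0 < r"
  have "tilt p y (r *\<^sub>R x) / r \<le> tilt p y x"
  proof (rule tilt_ge)
    fix t :: real assume t: "0 \<le> t"
    have "tilt p y (r *\<^sub>R x) \<le> p (r *\<^sub>R x + (r * t) *\<^sub>R y) - (r * t) * p y"
      using r t by (intro tilt_le[OF p]) simp
    also have "r *\<^sub>R x + (r * t) *\<^sub>R y = r *\<^sub>R (x + t *\<^sub>R y)" by (simp add: algebra_simps)
    also have "p \<dots> = r * p (x + t *\<^sub>R y)" using r by (intro sublinear_scale[OF p]) simp
    finally show "tilt p y (r *\<^sub>R x) / r \<le> p (x + t *\<^sub>R y) - t * p y"
      using r by (simp add: field_simps)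
  qed
  then show "tilt p y (r *\<^sub>R x) \<le> r * tilt p y x" using r by (simp add: field_simps)
qed

lemma tilt_le_self: "sublinear p \<Longrightarrow> tilt p y \<le> p"
  using tilt_le[of p 0 y] by (simp add: le_fun_def)

text \<open>Hahn--Banach: tilting a minimal sublinear functional does not change it, so it is additive.\<close>

lemma minimal_sublinear_linear:
  assumes q: "sublinear q" and min: "\<And>r. sublinear r \<Longrightarrow> r \<le> q \<Longrightarrow> r = q"
  shows "linear q"
proof -
  have "q x + q y \<le> q (x + y)" for x y
    using tilt_le[OF q, of 1 y x] min[OF sublinear_tilt[OF q] tilt_le_self[OF q], of y] by simp
  then have add: "q (x + y) = q x + q y" for x y
    using sublinear_add[OF q] by (simp add: order_antisym)
  then have neg: "q (- x) = - q x" for x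
    using add[of x "- x"] sublinear_zero[OF q] by simp
  show ?thesis
  proof
    fix r :: real and x
    show "q (r *\<^sub>R x) = r *\<^sub>R q x"
    proof (cases "0 \<le> r")
      case False
      then have "q ((- r) *\<^sub>R x) = (- r) * q x" by (intro sublinear_scale[OF q]) simp
      then show ?thesis using neg[of "r *\<^sub>R x"] by simp
    qed (simp add: sublinear_scale[OF q])
  qed (rule add)
qed

text \<open>Minimizing below \<open>tilt p a\<close> instead of below \<open>p\<close> is what
  forces equality at \<open>a\<close>.\<close>

lemma sublinear_dominates_linear:
  assumes p: "sublinear (p :: 'v::real_vector \<Rightarrow> real)"
  shows "\<exists>f. linear f \<and> (\<forall>x. f x \<le> p x) \<and> f a = p a"
proof -
  obtain q where q: "sublinear q" "q \<le> tilt p a" "\<And>r. sublinear r \<Longrightarrow> r \<le> q \<Longrightarrow> r = q"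
    using minimal_sublinear_exists[OF sublinear_tilt[OF p]] by metis
  then have lin: "linear q" by (intro minimal_sublinear_linear)
  have le: "q x \<le> p x" for x
    using q(2) tilt_le_self[OF p, of a] by (meson le_funD order_trans)
  have "q (- a) \<le> - p a"
    using q(2) tilt_le[OF p, of 1 a "- a"] sublinear_zero[OF p] by (smt (verit) le_funD
      add.left_inverse scaleR_one mult_1)
  then have "p a \<le> q a" by (simp add: linear_neg[OF lin])
  with lin le show ?thesis by (auto intro!: exI[of _ q] antisym)
qed

section \<open>M-projections on complex Banach algebras\<close>

lemma scaleC_zero_right [simp]: "scaleC c (0::'v::complex_banach_algebra) = 0"
  using scaleC_add_right[of c "0::'v" 0] by simp

lemma scaleC_minus_right [simp]: "scaleC c (- x) = - scaleC c (x::'v::complex_banach_algebra)"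
  using scaleC_add_right[of c x "- x"] by (simp add: eq_neg_iff_add_eq_0 add.commute)

lemma scaleC_diff_right: "scaleC c (x - y) = scaleC c x - scaleC c (y::'v::complex_banach_algebra)"
  using scaleC_add_right[of c x "- y"] by simp

lemma scaleC_zero_left [simp]: "scaleC 0 (x::'v::complex_banach_algebra) = 0"
  using scaleC_add_left[of 0 0 x] by simp

lemma scaleC_minus_left [simp]: "scaleC (- c) (x::'v::complex_banach_algebra) = - scaleC c x"
  using scaleC_add_left[of c "- c" x] by (simp add: eq_neg_iff_add_eq_0 add.commute)

lemma scaleC_diff_left:
  "scaleC (c - d) (x::'v::complex_banach_algebra) = scaleC c x - scaleC d x"
  using scaleC_add_left[of c "- d" x] by simp

definition clinear_op :: "('v::complex_banach_algebra \<Rightarrow> 'v) \<Rightarrow> bool" where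
  "clinear_op T \<longleftrightarrow> (\<forall>x y. T (x + y) = T x + T y) \<and> (\<forall>c x. T (scaleC c x) = scaleC c (T x))"

lemma clinear_op_add: "clinear_op T \<Longrightarrow> T (x + y) = T x + T y"
  and clinear_op_scaleC: "clinear_op T \<Longrightarrow> T (scaleC c x) = scaleC c (T x)"
  by (simp_all add: clinear_op_def)

lemma clinear_op_zero: "clinear_op T \<Longrightarrow> T 0 = 0"
  using clinear_op_add[of T 0 0] by simp

lemma clinear_op_diff: "clinear_op T \<Longrightarrow> T (x - y) = T x - T y"
  using clinear_op_add[of T "x - y" y] by (simp add: algebra_simps)

section \<open>M-projections and the operators commuting with them\<close>

definition Mprojection :: "('v::complex_banach_algebra \<Rightarrow> 'v) \<Rightarrow> bool" where
  "Mprojection P \<longleftrightarrow> clinear_op P \<and> (\<forall>x. P (P x) = P x) \<and>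
     (\<forall>x. norm x = max (norm (P x)) (norm (x - P x)))"

lemma Mprojection_clinear: "Mprojection P \<Longrightarrow> clinear_op P"
  and Mprojection_idem: "Mprojection P \<Longrightarrow> P (P x) = P x"
  and Mprojection_norm: "Mprojection P \<Longrightarrow> norm x = max (norm (P x)) (norm (x - P x))"
  unfolding Mprojection_def by blast+

lemma Mprojection_complement:
  assumes "Mprojection P"
  shows "Mprojection (\<lambda>x. x - P x)"
proof -
  note l = Mprojection_clinear[OF assms]
  show ?thesis
    unfolding Mprojection_def clinear_op_def
  proof (intro conjI allI)
    show "norm x = max (norm (x - P x)) (norm (x - (x - P x)))" for x
      using Mprojection_norm[OF assms, of x] by (simp add: max.commute)
  qed (simp_all add: clinear_op_add[OF l] clinear_op_scaleC[OF l] clinear_op_diff[OF l]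
      Mprojection_idem[OF assms] scaleC_diff_right)
qed

lemma Mprojection_norm_le:
  assumes "Mprojection P"
  shows "norm (P x) \<le> norm x" and "norm (x - P x) \<le> norm x"
  using Mprojection_norm[OF assms, of x] by auto

lemma Mprojection_norm_add:
  assumes P: "Mprojection P" and "P x = x" "P y = 0"
  shows "norm (x + y) = max (norm x) (norm y)"
  using Mprojection_norm[OF P, of "x + y"] clinear_op_add[OF Mprojection_clinear[OF P], of x y] assms
  by simp

text \<open>Contractivity will be assumed for unimodular \<mu> only, so the small parameter of the
  perturbation argument has to be \<mu> - 1 on the unit circle.\<close>

lemma unimodular_near_one:
  assumes "0 < (e::real)"
  shows "\<exists>\<mu>::complex. cmod \<mu> = 1 \<and> 0 < cmod (\<mu> - 1) \<and> cmod (\<mu> - 1) < e"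
proof -
  have "(cis \<longlongrightarrow> cis 0) (at_right 0)"
    by (intro tendsto_intros)
  then have "\<forall>\<^sub>F t in at_right 0. dist (cis t) (cis 0) < e"
    using assms by (rule tendstoD)
  moreover have "\<forall>\<^sub>F t::real in at_right 0. t < 1" 
    by (rule eventually_at_rightI[of 0 1]) auto
  moreover have "\<forall>\<^sub>F t::real in at_right 0. 0 < t"
    by (rule eventually_at_rightI[of 0 1]) auto
  ultimately have "\<forall>\<^sub>F t::real in at_right 0. dist (cis t) (cis 0) < e \<and> t < 1 \<and> 0 < t"
    by eventually_elim auto
  then obtain t :: real where t: "dist (cis t) (cis 0) < e" "t < 1" "0 < t"
    using eventually_happens[of _ "at_right (0::real)"] trivial_limit_at_right_real by blast
  have "sin t > 0" using t pi_gt3 by (intro sin_gt_zero) auto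
  then have "cis t \<noteq> 1" by (metis Im_complex_of_real cis.simps(2) less_irrefl of_real_1)
  with t show ?thesis by (intro exI[of _ "cis t"]) (auto simp: dist_norm)
qed

text \<open>The operators \<open>1 + (\<mu> - 1)T\<close> are isometries up to second order. If \<open>y = (1 - P)Tx\<close> were
nonzero for some \<open>x\<close> in the range of \<open>P\<close>, adding to \<open>x\<close> a multiple \<open>u\<close> of \<open>y\<close> with
\<open>\<parallel>u\<parallel> = \<parallel>x\<parallel>\<close> would not change the norm of \<open>x\<close>, but the \<open>u\<close>-component of the image would grow
to first order.\<close>

lemma Mprojection_range_invariant:
  assumes P: "Mprojection P" and T: "clinear_op T"
    and contr: "\<And>\<mu> x. cmod \<mu> = 1 \<Longrightarrow> norm (x + scaleC (\<mu> - 1) (T x)) \<le> norm x"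
    and x: "P x = x"
  shows "P (T x) = T x"
proof (rule ccontr)
  assume neq: "P (T x) \<noteq> T x"
  define Q where "Q v = v - P v" for v
  have Q: "Mprojection Q" unfolding Q_def using Mprojection_complement[OF P] .
  note Ql = Mprojection_clinear[OF Q]
  define T' where "T' v = Q (T v)" for v
  have T': "clinear_op T'"
    using T Ql by (simp add: clinear_op_def T'_def)
  define y where "y = Q (T x)"
  define r where "r = norm x"
  define \<eta> where "\<eta> = norm y"
  have \<eta>: "\<eta> > 0" using neq by (simp add: \<eta>_def y_def Q_def)
  have r: "r > 0"
  proof -
    have "x \<noteq> 0" using neq clinear_op_zero[OF T] clinear_op_zero[OF Mprojection_clinear[OF P]] by auto
    then show ?thesis by (simp add: r_def)
  qed
  \<comment> \<open>The choice \<mu> = -1 makes 1 - 2T contractive, and 2T = 1 - (1 - 2T).\<close>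
  have T_le: "norm (T v) \<le> norm v" for v
  proof -
    have "2 * norm (T v) = norm (scaleC (-2) (T v))" by (simp add: norm_scaleC)
    also have "\<dots> = norm ((v + scaleC (-2) (T v)) - v)" by simp
    also have "\<dots> \<le> norm v + norm v"
      by (rule order_trans[OF norm_triangle_ineq4]) (use contr[of "-1" v] in auto)
    finally show ?thesis by simp
  qed
  have T'_le: "norm (T' v) \<le> norm v" for v
    unfolding T'_def using Mprojection_norm_le(1)[OF Q] T_le order_trans by blast
  have Qcontr: "norm (Q v + scaleC (\<mu> - 1) (T' v)) \<le> norm v" if "cmod \<mu> = 1" for \<mu> v
  proof -
    have "Q v + scaleC (\<mu> - 1) (T' v) = Q (v + scaleC (\<mu> - 1) (T v))"
      by (simp add: T'_def clinear_op_add[OF Ql] clinear_op_scaleC[OF Ql])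
    then show ?thesis using Mprojection_norm_le(1)[OF Q] contr[OF that] order_trans by metis
  qed
  define u where "u = scaleC (complex_of_real (r / \<eta>)) y"
  have Qy: "Q y = y" and Qx: "Q x = 0"
    using Mprojection_idem[OF Q] x by (simp_all add: y_def Q_def)
  have Qu: "Q u = u" by (simp add: u_def clinear_op_scaleC[OF Ql] Qy)
  then have Pu: "P u = 0" by (simp add: Q_def)
  have u: "norm u = r" using \<eta> r unfolding u_def norm_scaleC norm_of_real \<eta>_def by simp
  have yu: "y = scaleC (complex_of_real (\<eta> / r)) u"
    using \<eta> r by (simp add: u_def scaleC_scaleC scaleC_one flip: of_real_mult of_real_divide)
  have bound: "\<eta> \<le> s * (2 * r + \<eta>)" if "cmod \<mu> = 1" "s = cmod (\<mu> - 1)" "0 < s" for s \<mu>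
  proof -
    define a where "a = \<mu> - 1"
    \<comment> \<open>The factor for the conjugate of \<mu> is applied after the one for \<mu>. It
      cancels the unwanted first-order term \<open>a \<theta> T' u\<close> up to a + b = -s^2, while
      the gain \<open>a y\<close> survives because Q has removed x before the second factor
      acts.\<close>
    define b where "b = cnj \<mu> - 1"
    \<comment> \<open>The phase of a: now \<open>\<theta> u\<close> and \<open>a y\<close> are
      multiples of u with the same phase, so the norm of their sum is r + s \<eta>.\<close>
    define \<theta> where "\<theta> = a / complex_of_real s"
    have ab: "a * b = complex_of_real (s\<^sup>2)"
      using complex_norm_square[of a] that(2) by (simp add: a_def b_def)
    have "a + b = - (a * b)"
      using that(1) complex_norm_square[of \<mu>] by (simp add: a_def b_def algebra_simps)
    then have apb: "a + b = - complex_of_real (s\<^sup>2)" using ab by simp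
    have \<theta>: "cmod \<theta> = 1" using that by (simp add: \<theta>_def a_def norm_divide)
    have a: "a = \<theta> * complex_of_real s" using that by (simp add: \<theta>_def)
    define g where "g = Q (x + scaleC \<theta> u) + scaleC a (T' (x + scaleC \<theta> u))"
    have "P (scaleC \<theta> u) = 0"
      by (simp add: clinear_op_scaleC[OF Mprojection_clinear[OF P]] Pu)
    then have "norm (x + scaleC \<theta> u) = r"
      using Mprojection_norm_add[OF P x] by (simp add: u norm_scaleC \<theta> r_def)
    then have g_le: "norm g \<le> r" using Qcontr[OF that(1), of "x + scaleC \<theta> u"] by (simp add: g_def a_def)
    have T'x: "T' x = y" by (simp add: T'_def y_def)
    have g: "g = scaleC \<theta> u + scaleC a y + scaleC (a * \<theta>) (T' u)"
      by (simp add: g_def clinear_op_add[OF Ql] clinear_op_add[OF T'] clinear_op_scaleC[OF Ql]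
          clinear_op_scaleC[OF T'] Qu Qx T'x scaleC_add_right scaleC_scaleC)
    have Qg: "Q g = g"
      by (simp add: g clinear_op_add[OF Ql] clinear_op_scaleC[OF Ql] Qu Qy T'_def Mprojection_idem[OF Q])
    define h where "h = g + scaleC b (T' g)"
    have h_le: "norm h \<le> r"
      using Qcontr[of "cnj \<mu>" g] that(1) g_le by (simp add: h_def b_def Qg)
    \<comment> \<open>All remaining terms of h carry the factor s^2, and the norm of R is at most 2r
      + \<eta>.\<close>
    define R where "R = - scaleC \<theta> (T' u) + T' y + scaleC \<theta> (T' (T' u))"
    have "h = scaleC \<theta> u + scaleC a y + (scaleC ((a + b) * \<theta>) (T' u)
        + scaleC (a * b) (T' y) + scaleC (a * b) (scaleC \<theta> (T' (T' u))))"
      by (simp add: h_def g clinear_op_add[OF T'] clinear_op_scaleC[OF T'] scaleC_add_right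
          scaleC_scaleC scaleC_add_left algebra_simps)
    also have "scaleC \<theta> u + scaleC a y = scaleC (\<theta> * complex_of_real (1 + s * \<eta> / r)) u"
      unfolding yu a scaleC_scaleC scaleC_add_left[symmetric] by (simp add: algebra_simps)
    also have "scaleC ((a + b) * \<theta>) (T' u) + scaleC (a * b) (T' y) + scaleC (a * b) (scaleC \<theta> (T' (T' u)))
        = scaleC (complex_of_real (s\<^sup>2)) R"
      unfolding apb ab R_def by (simp add: scaleC_add_right scaleC_scaleC scaleC_diff_right)
    finally have h: "scaleC (\<theta> * complex_of_real (1 + s * \<eta> / r)) u = h - scaleC (complex_of_real (s\<^sup>2)) R"
      by simp
    have sr: "0 \<le> s * \<eta> / r" using that \<eta> r by simp
    have "r + s * \<eta> = norm (scaleC (\<theta> * complex_of_real (1 + s * \<eta> / r)) u)"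
      unfolding norm_scaleC norm_mult norm_of_real \<theta> u using sr r by (simp add: field_simps)
    also have "\<dots> \<le> norm h + s\<^sup>2 * norm R"
      unfolding h by (rule order_trans[OF norm_triangle_ineq4]) (simp add: norm_scaleC norm_power)
    also have "norm R \<le> norm u + norm y + norm u"
    proof -
      have "norm R \<le> norm (- scaleC \<theta> (T' u)) + norm (T' y) + norm (scaleC \<theta> (T' (T' u)))"
        unfolding R_def by (intro norm_triangle_mono norm_triangle_ineq order_refl)
      moreover have "norm (T' (T' u)) \<le> norm u" using T'_le order_trans by blast
      ultimately show ?thesis using T'_le[of u] T'_le[of y] by (simp add: norm_scaleC \<theta>)
    qed
    finally have "r + s * \<eta> \<le> norm h + s\<^sup>2 * (2 * r + \<eta>)" by (simp add: u \<eta>_def mult_left_mono)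
    then have "s * \<eta> \<le> s * (s * (2 * r + \<eta>))" using h_le by (simp add: power2_eq_square algebra_simps)
    then show ?thesis using that by simp
  qed
  \<comment> \<open>Below this threshold the inequality \<open>bound\<close> fails.\<close>
  define e where "e = \<eta> / (2 * r + \<eta>)"
  have "e > 0" using \<eta> r by (simp add: e_def)
  then obtain \<mu> :: complex where "cmod \<mu> = 1" "0 < cmod (\<mu> - 1)" "cmod (\<mu> - 1) < e"
    using unimodular_near_one by blast
  then have "\<eta> \<le> cmod (\<mu> - 1) * (2 * r + \<eta>)" "cmod (\<mu> - 1) * (2 * r + \<eta>) < e * (2 * r + \<eta>)"
    using bound \<eta> r by (auto intro!: mult_strict_right_mono)
  then show False using \<eta> r by (simp add: e_def)
qed

text \<open>Range invariance applied to P and to 1 - P: T maps both summands of x = Px + (x - Px)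
  into themselves.\<close>

lemma Mprojection_commute:
  assumes P: "Mprojection P" and T: "clinear_op T"
    and contr: "\<And>\<mu> x. cmod \<mu> = 1 \<Longrightarrow> norm (x + scaleC (\<mu> - 1) (T x)) \<le> norm x"
  shows "P (T x) = T (P x)"
proof -
  note Pl = Mprojection_clinear[OF P]
  have "P (T (P x)) = T (P x)"
    by (rule Mprojection_range_invariant[OF P T contr Mprojection_idem[OF P]])
  moreover have "T (x - P x) - P (T (x - P x)) = T (x - P x)"
    by (rule Mprojection_range_invariant[OF Mprojection_complement[OF P] T contr])
      (simp_all add: clinear_op_diff[OF Pl] Mprojection_idem[OF P])
  ultimately show ?thesis
    by (simp add: clinear_op_diff[OF T] clinear_op_diff[OF Pl])
qed

text \<open>The twist multiplies the Q-part by \<mu> and keeps the other part, which the maximum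
  norm does not notice. Hence M-projections can take the role of T in
  \<open>Mprojection_commute\<close>.\<close>

lemma Mprojection_twist_le:
  assumes Q: "Mprojection Q" and "cmod \<mu> = 1"
  shows "norm (x + scaleC (\<mu> - 1) (Q x)) \<le> norm x"
proof -
  note Ql = Mprojection_clinear[OF Q]
  have "x + scaleC (\<mu> - 1) (Q x) = scaleC \<mu> (Q x) + (x - Q x)"
    by (simp add: scaleC_diff_left scaleC_one)
  also have "norm \<dots> = max (norm (scaleC \<mu> (Q x))) (norm (x - Q x))"
    by (rule Mprojection_norm_add[OF Q])
      (simp_all add: clinear_op_scaleC[OF Ql] clinear_op_diff[OF Ql] Mprojection_idem[OF Q])
  also have "\<dots> = norm x" using Mprojection_norm[OF Q, of x] assms(2) by (simp add: norm_scaleC)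
  finally show ?thesis by simp
qed

text \<open>Two M-projections commute, and for a common range this gives Px = QPx = PQx = Qx. The
  definite description in \<open>supp\<close> relies on it.\<close>

lemma Mprojection_unique:
  assumes P: "Mprojection P" and Q: "Mprojection Q" and "range P = range Q"
  shows "P = Q"
proof
  fix x
  have "Q (P x) = P x" "P (Q x) = Q x"
    using assms(3) Mprojection_idem[OF P] Mprojection_idem[OF Q] by (metis rangeE rangeI)+
  moreover have "P (Q x) = Q (P x)"
    by (rule Mprojection_commute[OF P Mprojection_clinear[OF Q] Mprojection_twist_le[OF Q]])
  ultimately show "P x = Q x" by simp
qed

text \<open>The unit is a parameter, because \<open>\<parallel>1\<parallel> = 1\<close> fails in the bidual of the zero algebra.\<close>

definition contractive_unit :: "'v::complex_banach_algebra \<Rightarrow> bool" where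
  "contractive_unit e \<longleftrightarrow> (\<forall>x. e * x = x \<and> x * e = x) \<and> norm e \<le> 1"

section \<open>The image of the unit under an M-projection\<close>

lemma contractive_unit_mult: "contractive_unit e \<Longrightarrow> e * x = x" "contractive_unit e \<Longrightarrow> x * e = x"
  by (simp_all add: contractive_unit_def)

lemma clinear_op_mult_left: "clinear_op (\<lambda>x. a * x)"
  by (simp add: clinear_op_def distrib_left scaleC_mult_right)

text \<open>For T = left multiplication by e - Pe, the operator 1 + (\<mu> - 1)T is left
  multiplication by the twist of e along 1 - P. That element has norm at most 1, and
  submultiplicativity gives contractivity.\<close>

lemma Mprojection_mult_complement_unit:
  assumes P: "Mprojection P" and e: "contractive_unit e"
  shows "P ((e - P e) * x) = (e - P e) * P x"
proof (rule Mprojection_commute[OF P clinear_op_mult_left])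
  fix \<mu> :: complex and x
  assume \<mu>: "cmod \<mu> = 1"
  have "x + scaleC (\<mu> - 1) ((e - P e) * x) = (e + scaleC (\<mu> - 1) (e - P e)) * x"
    by (simp add: distrib_right contractive_unit_mult[OF e] scaleC_mult_left)
  moreover have "norm (e + scaleC (\<mu> - 1) (e - P e)) \<le> 1"
    using Mprojection_twist_le[OF Mprojection_complement[OF P] \<mu>, of e] e
    by (simp add: contractive_unit_def)
  ultimately show "norm (x + scaleC (\<mu> - 1) ((e - P e) * x)) \<le> norm x"
    using norm_mult_ineq[of "e + scaleC (\<mu> - 1) (e - P e)" x]
    by (metis mult_left_le_one_le mult.commute norm_ge_zero order_trans)
qed

lemma Mprojection_unit_idem:
  assumes P: "Mprojection P" and e: "contractive_unit e"
  shows "P e * P e = P e"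
proof -
  have "(e - P e) * P e = P ((e - P e) * e)"
    by (rule Mprojection_mult_complement_unit[OF assms, symmetric])
  also have "\<dots> = 0"
    by (simp add: contractive_unit_mult[OF e] clinear_op_diff[OF Mprojection_clinear[OF P]]
        Mprojection_idem[OF P])
  finally show ?thesis by (simp add: left_diff_distrib contractive_unit_mult[OF e])
qed

text \<open>A quantitative trace of the fact that the identity of a normed algebra is an extreme
  point of the unit ball, with \<open>w\<close> acting as identity on \<open>v\<close>. A bound
  below 1 suffices, since it is applied to a vector of norm one.\<close>

lemma idempotent_vertex:
  fixes w v :: "'v::complex_banach_algebra"
  assumes "w * w = w" "w * v = v" "v * w = v" "norm (w + v) \<le> 1" "norm (w - v) \<le> 1"
  shows "norm v \<le> 1/2"
proof -
  have "4 * norm v = norm ((4::real) *\<^sub>R v)" by simp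
  also have "(4::real) *\<^sub>R v = (w + v) * (w + v) - (w - v) * (w - v)"
  proof -
    have "(4::real) *\<^sub>R v = (v + v) + (v + v)" by (simp flip: scaleR_2)
    then show ?thesis by (simp add: distrib_left distrib_right left_diff_distrib right_diff_distrib assms(1-3))
  qed
  also have "norm \<dots> \<le> norm (w + v) * norm (w + v) + norm (w - v) * norm (w - v)"
    by (intro order_trans[OF norm_triangle_ineq4] add_mono norm_mult_ineq)
  also have "\<dots> \<le> 1 + 1"
    using assms(4,5) by (intro add_mono mult_le_one) auto
  finally show ?thesis by simp
qed

lemma Mprojection_mult_complement_zero:
  assumes P: "Mprojection P" and e: "contractive_unit e" and comm: "\<And>x. P e * x = x * P e"
  shows "(e - P e) * P x = 0"
proof (rule ccontr)
  define w where "w = e - P e"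
  note Pl = Mprojection_clinear[OF P]
  define v where "v = w * P x"
  assume "(e - P e) * P x \<noteq> 0"
  then have v: "v \<noteq> 0" by (simp add: v_def w_def)
  have ww: "w * w = w"
    using Mprojection_unit_idem[OF P e]
    by (simp add: w_def algebra_simps contractive_unit_mult[OF e])
  have wc: "w * y = y * w" for y
    by (simp add: w_def algebra_simps contractive_unit_mult[OF e] comm)
  have wv: "w * v = v" by (simp add: v_def ww flip: mult.assoc)
  have Pv: "P v = v"
    using Mprojection_mult_complement_unit[OF P e, of "P x"]
    by (simp add: v_def w_def Mprojection_idem[OF P])
  define k where "k = complex_of_real (1 / norm v)"
  define v' where "v' = scaleC k v"
  have nv': "norm v' = 1" using v unfolding v'_def k_def norm_scaleC norm_of_real by simp
  have wv': "w * v' = v'" by (simp add: v'_def wv flip: scaleC_mult_right)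
  have Pv': "P v' = v'" by (simp add: v'_def clinear_op_scaleC[OF Pl] Pv)
  have Pw: "P w = 0" by (simp add: w_def clinear_op_diff[OF Pl] Mprojection_idem[OF P])
  have nw: "norm w \<le> 1"
    using Mprojection_norm_le(2)[OF P, of e] e by (simp add: w_def contractive_unit_def)
  have "norm (v' + w) \<le> 1" using Mprojection_norm_add[OF P Pv' Pw] nv' nw by simp
  moreover have "norm (- v' + w) \<le> 1"
    using Mprojection_norm_add[OF P _ Pw, of "- v'"] nv' nw clinear_op_diff[OF Pl, of 0 v'] Pv'
    by (simp add: clinear_op_zero[OF Pl])
  ultimately have "norm v' \<le> 1/2"
    using ww wv' wc[of v'] by (intro idempotent_vertex[of w]) (simp_all add: algebra_simps)
  then show False using nv' by simp
qed

text \<open>With z = Pe, the preceding result for P gives (1 - z)Px = 0, and for 1 - P it gives z(x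
  - Px) = 0. Hence Px = zPx = zx.\<close>

lemma Mprojection_eq_mult:
  assumes P: "Mprojection P" and e: "contractive_unit e" and comm: "\<And>x. P e * x = x * P e"
  shows "P x = P e * x"
proof -
  have "P x = P e * P x"
    using Mprojection_mult_complement_zero[OF assms, of x]
    by (simp add: left_diff_distrib contractive_unit_mult[OF e])
  moreover have "(e - (e - P e)) * (x - P x) = 0"
    using Mprojection_mult_complement_zero[OF Mprojection_complement[OF P] e, of x] comm
    by (simp add: algebra_simps contractive_unit_mult[OF e])
  ultimately show ?thesis by (simp add: algebra_simps)
qed

text \<open>For a central idempotent the norm condition expresses that multiplication by
  \<open>z\<close> is an M-projection. The form with two vectors, \<open>x\<close> glued to
  \<open>y\<close> along \<open>z\<close>, can be iterated for products and joins and passes to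
  weak* limits.\<close>

definition Mcentral :: "'v::complex_banach_algebra \<Rightarrow> bool" where
  "Mcentral z \<longleftrightarrow> z * z = z \<and> (\<forall>x. z * x = x * z) \<and>
     (\<forall>x y. norm (z * x + (y - z * y)) \<le> max (norm x) (norm y))"

lemma Mcentral_idem: "Mcentral z \<Longrightarrow> z * z = z"
  and Mcentral_comm: "Mcentral z \<Longrightarrow> z * x = x * z"
  and Mcentral_norm: "Mcentral z \<Longrightarrow> norm (z * x + (y - z * y)) \<le> max (norm x) (norm y)"
  unfolding Mcentral_def by blast+

lemma Mcentral_zero: "Mcentral 0"
  by (simp add: Mcentral_def)

text \<open>Glue x to y along u, then glue the result to y along z.\<close>

lemma Mcentral_mult:
  assumes z: "Mcentral z" and u: "Mcentral u"
  shows "Mcentral (z * u)"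
  unfolding Mcentral_def
proof (intro conjI allI)
  have "z * u * (z * u) = z * (u * z) * u" by (simp add: mult.assoc)
  also have "\<dots> = z * u" by (metis Mcentral_comm Mcentral_idem mult.assoc u z)
  finally show "z * u * (z * u) = z * u" .
  show "z * u * x = x * (z * u)" for x by (metis Mcentral_comm mult.assoc u z)
  fix x y
  have "z * u * x + (y - z * u * y) = z * (u * x + (y - u * y)) + (y - z * y)"
    by (simp add: algebra_simps)
  also have "norm \<dots> \<le> max (norm (u * x + (y - u * y))) (norm y)" by (rule Mcentral_norm[OF z])
  also have "\<dots> \<le> max (norm x) (norm y)" using Mcentral_norm[OF u, of x y] by simp
  finally show "norm (z * u * x + (y - z * u * y)) \<le> max (norm x) (norm y)" .
qed

text \<open>The supremum 1 - (1 - z)(1 - u) of two commuting idempotents, written without the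
  unit.\<close>

definition proj_join :: "'v::complex_banach_algebra \<Rightarrow> 'v \<Rightarrow> 'v" where
  "proj_join z u = z + u - z * u"

lemma proj_join_upper:
  assumes "Mcentral z" "Mcentral u"
  shows "z * proj_join z u = z" "u * proj_join z u = u"
proof -
  show "z * proj_join z u = z"
    by (simp add: proj_join_def distrib_left right_diff_distrib Mcentral_idem[OF assms(1)] flip: mult.assoc)
  have "u * (z * u) = u * z" by (metis Mcentral_comm Mcentral_idem assms mult.assoc)
  then show "u * proj_join z u = u"
    by (simp add: proj_join_def algebra_simps Mcentral_idem[OF assms(2)])
qed

text \<open>Dual to the product: glue x to y along u, then glue x to the result along z.\<close>

lemma Mcentral_join:
  assumes z: "Mcentral z" and u: "Mcentral u"
  shows "Mcentral (proj_join z u)"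
  unfolding Mcentral_def
proof (intro conjI allI)
  have c: "proj_join z u * x = x * proj_join z u" for x
    using Mcentral_comm[OF z, of x] Mcentral_comm[OF u, of x] Mcentral_comm[OF Mcentral_mult[OF z u], of x]
    by (simp add: proj_join_def algebra_simps)
  then show "proj_join z u * x = x * proj_join z u" for x .
  have "proj_join z u * proj_join z u
      = z * proj_join z u + u * proj_join z u - z * (u * proj_join z u)"
    by (subst (1) proj_join_def) (simp add: algebra_simps)
  also have "\<dots> = proj_join z u"
    by (simp only: proj_join_upper[OF z u]) (simp add: proj_join_def)
  finally show "proj_join z u * proj_join z u = proj_join z u" .
  fix x y
  have "proj_join z u * x + (y - proj_join z u * y)
      = z * x + ((u * x + (y - u * y)) - z * (u * x + (y - u * y)))"
    by (simp add: proj_join_def algebra_simps)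
  also have "norm \<dots> \<le> max (norm x) (norm (u * x + (y - u * y)))" by (rule Mcentral_norm[OF z])
  also have "\<dots> \<le> max (norm x) (norm y)" using Mcentral_norm[OF u, of x y] by simp
  finally show "norm (proj_join z u * x + (y - proj_join z u * y)) \<le> max (norm x) (norm y)" .
qed

text \<open>The gluing condition at (zx, x - zx) bounds the norm of x by the maximum; at (x, 0) and
  (0, x) it bounds the two parts by the norm of x.\<close>

lemma Mcentral_Mprojection:
  assumes z: "Mcentral z"
  shows "Mprojection (\<lambda>x. z * x)"
  unfolding Mprojection_def
proof (intro conjI allI clinear_op_mult_left)
  fix x
  show idem: "z * (z * x) = z * x" by (simp add: Mcentral_idem[OF z] flip: mult.assoc)
  show "norm x = max (norm (z * x)) (norm (x - z * x))"
  proof (rule antisym)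
    show "norm x \<le> max (norm (z * x)) (norm (x - z * x))"
      using Mcentral_norm[OF z, of "z * x" "x - z * x"] by (simp add: idem algebra_simps)
    show "max (norm (z * x)) (norm (x - z * x)) \<le> norm x"
      using Mcentral_norm[OF z, of x 0] Mcentral_norm[OF z, of 0 x] by simp
  qed
qed

lemma Mprojection_Mcentral:
  assumes P: "Mprojection P" and e: "contractive_unit e" and comm: "\<And>x. P e * x = x * P e"
  shows "Mcentral (P e)"
  unfolding Mcentral_def
proof (intro conjI allI comm Mprojection_unit_idem[OF P e])
  fix x y
  note Pl = Mprojection_clinear[OF P]
  have "norm (P x + (y - P y)) = max (norm (P x)) (norm (y - P y))"
    by (rule Mprojection_norm_add[OF P]) (simp_all add: clinear_op_diff[OF Pl] Mprojection_idem[OF P])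
  also have "\<dots> \<le> max (norm x) (norm y)"
    using Mprojection_norm_le[OF P] by (meson max.mono)
  finally show "norm (P e * x + (y - P e * y)) \<le> max (norm x) (norm y)"
    by (simp add: Mprojection_eq_mult[OF P e comm, symmetric])
qed

section \<open>The multiplier unitization and its dual\<close>

text \<open>The product type supplies addition and real scalars, so that
  \<open>sublinear_dominates_linear\<close> applies to pairs. Their size is always measured by
  \<open>unorm\<close>.\<close>

lemma uadd_eq: "uadd x y = x + y"
  by (simp add: uadd_def prod_eq_iff)

lemma uscale_of_real: "uscale (complex_of_real r) x = r *\<^sub>R x"
  by (simp add: uscale_def prod_eq_iff scaleC_of_real scaleR_conv_of_real)

lemma uscale_uscale: "uscale c (uscale d x) = uscale (c * d) x"
  by (simp add: uscale_def scaleC_scaleC mult.assoc)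

lemma uscale_one [simp]: "uscale 1 x = x"
  by (simp add: uscale_def scaleC_one)

lemma uscale_add_right: "uscale c (x + y) = uscale c x + uscale c y"
  by (simp add: uscale_def prod_eq_iff scaleC_add_right distrib_left)

lemma uscale_add_left: "uscale (c + d) x = uscale c x + uscale d x"
  by (simp add: uscale_def prod_eq_iff scaleC_add_left distrib_right)

lemma uscale_minus_left: "uscale (- c) x = - uscale c x"
  by (simp add: uscale_def prod_eq_iff)

lemma umult_add_right: "umult x (y + y') = umult x y + umult x y'"
  and umult_add_left: "umult (x + x') y = umult x y + umult x' y"
  by (simp_all add: umult_def prod_eq_iff distrib_left distrib_right scaleC_add_right scaleC_add_left)

lemma umult_uscale_right: "umult x (uscale c y) = uscale c (umult x y)"
  and umult_uscale_left: "umult (uscale c x) y = uscale c (umult x y)"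
  by (simp_all add: umult_def uscale_def scaleC_add_right scaleC_scaleC mult.commute
      flip: scaleC_mult_left scaleC_mult_right)

lemma umult_assoc: "umult (umult x y) z = umult x (umult y z)"
  by (simp add: umult_def prod_eq_iff distrib_left distrib_right scaleC_add_right scaleC_scaleC
      mult_ac add_ac flip: scaleC_mult_left scaleC_mult_right)

lemma umult_one [simp]: "umult (0, 1) x = x" "umult x (0, 1) = x"
  by (simp_all add: umult_def scaleC_one)

lemma inA_add: "inA (a + b) = inA a + inA b"
  and inA_diff: "inA (a - b) = inA a - inA b"
  and inA_zero: "inA 0 = 0"
  and inA_scaleC: "inA (scaleC c a) = uscale c (inA a)"
  and inA_mult: "inA (a * b) = umult (inA a) (inA b)"
  by (simp_all add: inA_def uscale_def umult_def prod_eq_iff)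

section \<open>The multiplier seminorm\<close>

definition uact :: "'a::complex_banach_algebra unit_el \<Rightarrow> 'a \<Rightarrow> 'a" where
  "uact x c = fst x * c + scaleC (snd x) c"

lemma unorm_eq: "unorm x = (SUP c\<in>{c. norm c \<le> 1}. norm (uact x c))"
  by (simp add: unorm_def uact_def)

lemma uact_norm_le: "norm (uact x c) \<le> (norm (fst x) + cmod (snd x)) * norm c"
  unfolding uact_def
  by (rule order_trans[OF norm_triangle_ineq])
    (simp add: norm_scaleC distrib_right norm_mult_ineq)

lemma uact_norm_le_unorm_unit:
  assumes "norm c \<le> 1"
  shows "norm (uact x c) \<le> unorm x"
  unfolding unorm_eq
proof (rule cSUP_upper)
  show "bdd_above ((\<lambda>c. norm (uact x c)) ` {c. norm c \<le> 1})"
  proof (rule bdd_aboveI2)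
    fix c :: 'a assume "c \<in> {c. norm c \<le> 1}"
    then show "norm (uact x c) \<le> norm (fst x) + cmod (snd x)"
      using uact_norm_le[of x c] mult_left_le[of "norm c" "norm (fst x) + cmod (snd x)"] by simp
  qed
qed (use assms in simp)

lemma unorm_le:
  assumes "\<And>c. norm c \<le> 1 \<Longrightarrow> norm (uact x c) \<le> K"
  shows "unorm x \<le> K"
  unfolding unorm_eq by (rule cSUP_least) (use assms in \<open>auto intro: exI[of _ 0]\<close>)

lemma unorm_nonneg [simp]: "0 \<le> unorm x"
  using uact_norm_le_unorm_unit[of 0 x] by (simp add: uact_def)

lemma uact_scaleR: "uact x (r *\<^sub>R c) = r *\<^sub>R uact x c"
proof -
  have "scaleC (snd x) (r *\<^sub>R c) = r *\<^sub>R scaleC (snd x) c"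
    by (simp add: scaleC_scaleC mult.commute flip: scaleC_of_real)
  then show ?thesis by (simp add: uact_def scaleR_add_right)
qed

lemma uact_norm_le_unorm: "norm (uact x c) \<le> unorm x * norm c"
proof (cases "c = 0")
  case False
  have "norm (uact x ((1 / norm c) *\<^sub>R c)) \<le> unorm x"
    by (rule uact_norm_le_unorm_unit) simp
  with False show ?thesis by (simp add: uact_scaleR field_simps)
qed (simp add: uact_def)

lemma unorm_add: "unorm (x + y) \<le> unorm x + unorm y"
proof (rule unorm_le)
  fix c :: 'a assume c: "norm c \<le> 1"
  have "uact (x + y) c = uact x c + uact y c"
    by (simp add: uact_def distrib_right scaleC_add_left)
  then show "norm (uact (x + y) c) \<le> unorm x + unorm y"
    using uact_norm_le_unorm_unit[OF c] by (metis add_mono norm_triangle_le)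
qed

lemma unorm_uscale_le: "unorm (uscale c x) \<le> cmod c * unorm x"
proof (rule unorm_le)
  fix b :: 'a assume b: "norm b \<le> 1"
  have "uact (uscale c x) b = scaleC c (uact x b)"
    by (simp add: uact_def uscale_def scaleC_add_right scaleC_mult_left scaleC_scaleC)
  then show "norm (uact (uscale c x) b) \<le> cmod c * unorm x"
    using uact_norm_le_unorm_unit[OF b] by (simp add: norm_scaleC mult_left_mono)
qed

lemma unorm_zero [simp]: "unorm 0 = 0"
  by (rule antisym[OF unorm_le]) (simp_all add: uact_def)

text \<open>\<open>uact\<close> represents pairs as left multiplications on \<open>A\<close>, and
  \<open>unorm\<close> is the operator norm there; products become compositions.\<close>

lemma unorm_umult: "unorm (umult x y) \<le> unorm x * unorm y"
proof (rule unorm_le)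
  fix c :: 'a assume c: "norm c \<le> 1"
  have "uact (umult x y) c = uact x (uact y c)"
    by (simp add: uact_def umult_def distrib_left distrib_right scaleC_add_right scaleC_scaleC
        mult.assoc add_ac flip: scaleC_mult_left scaleC_mult_right)
  also have "norm \<dots> \<le> unorm x * norm (uact y c)" by (rule uact_norm_le_unorm)
  also have "\<dots> \<le> unorm x * unorm y"
    by (intro mult_left_mono uact_norm_le_unorm_unit c) simp
  finally show "norm (uact (umult x y) c) \<le> unorm x * unorm y" .
qed

lemma unorm_one_le: "unorm (0, 1) \<le> 1"
  by (rule unorm_le) (simp add: uact_def scaleC_one)

lemma unorm_inA_le: "unorm (inA a) \<le> norm a"
proof (rule unorm_le)
  fix c :: 'a assume c: "norm c \<le> 1"
  have "norm (a * c) \<le> norm a * norm c" by (rule norm_mult_ineq)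
  also have "\<dots> \<le> norm a" using c by (simp add: mult_left_le)
  finally show "norm (uact (inA a) c) \<le> norm a" by (simp add: uact_def inA_def)
qed

text \<open>Along the approximate identity, norm(a e) tends to norm(a), so the supremum is not
  smaller than norm(a). Norm distances in \<open>A\<close> thereby become distances in the seminorm,
  as the separation of points from closed subspaces requires.\<close>

lemma unorm_inA:
  assumes "approx_unital TYPE('a::complex_banach_algebra)"
  shows "unorm (inA (a::'a)) = norm a"
proof (rule antisym[OF unorm_inA_le])
  obtain F :: "'a filter" where F: "F \<noteq> bot" "eventually (\<lambda>e. norm e \<le> 1) F"
    "((\<lambda>e. a * e) \<longlongrightarrow> a) F"
    using assms unfolding approx_unital_def by blast
  have "((\<lambda>e. norm (a * e)) \<longlongrightarrow> norm a) F" by (intro tendsto_norm F)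
  moreover have "eventually (\<lambda>e. norm (a * e) \<le> unorm (inA a)) F"
    using F(2)
  proof eventually_elim
    case (elim e)
    then show ?case using uact_norm_le_unorm_unit[of e "inA a"] by (simp add: uact_def inA_def)
  qed
  ultimately show "norm a \<le> unorm (inA a)" by (rule tendsto_upperbound) (rule F(1))
qed

section \<open>Bounded functionals on the unitization\<close>

lemma udualI:
  assumes "\<And>x y. \<phi> (x + y) = \<phi> x + \<phi> y" "\<And>c x. \<phi> (uscale c x) = c * \<phi> x"
    "\<And>x. cmod (\<phi> x) \<le> K * unorm x"
  shows "\<phi> \<in> udual"
  using assms unfolding udual_def uadd_eq by blast

lemma udual_add: "\<phi> \<in> udual \<Longrightarrow> \<phi> (x + y) = \<phi> x + \<phi> y"
  and udual_uscale: "\<phi> \<in> udual \<Longrightarrow> \<phi> (uscale c x) = c * \<phi> x"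
  unfolding udual_def uadd_eq by blast+

lemma udual_zero: "\<phi> \<in> udual \<Longrightarrow> \<phi> 0 = 0"
  using udual_add[of \<phi> 0 0] by simp

lemma dnorm_le:
  assumes "0 \<le> K" "\<And>x. cmod (\<phi> x) \<le> K * unorm x"
  shows "dnorm \<phi> \<le> K"
  unfolding dnorm_def
proof (rule cSUP_least)
  have "0 \<in> {x :: 'a unit_el. unorm x \<le> 1}" by simp
  then show "{x :: 'a unit_el. unorm x \<le> 1} \<noteq> {}" by blast
  fix x :: "'a unit_el" assume "x \<in> {x. unorm x \<le> 1}"
  then have "K * unorm x \<le> K" using assms(1) by (simp add: mult_left_le)
  then show "cmod (\<phi> x) \<le> K" using assms(2)[of x] by simp
qed

lemma dnorm_upper:
  assumes \<phi>: "\<phi> \<in> udual" and "unorm x \<le> 1"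
  shows "cmod (\<phi> x) \<le> dnorm \<phi>"
  unfolding dnorm_def
proof (rule cSUP_upper)
  obtain K where K: "\<And>x. cmod (\<phi> x) \<le> K * unorm x" using \<phi> unfolding udual_def by blast
  show "bdd_above ((\<lambda>x. cmod (\<phi> x)) ` {x. unorm x \<le> 1})"
  proof (rule bdd_aboveI2)
    fix x :: "'a unit_el" assume "x \<in> {x. unorm x \<le> 1}"
    then have "\<bar>K\<bar> * unorm x \<le> \<bar>K\<bar>" by (simp add: mult_left_le)
    moreover have "K * unorm x \<le> \<bar>K\<bar> * unorm x" by (intro mult_right_mono) auto
    ultimately show "cmod (\<phi> x) \<le> \<bar>K\<bar>" using K[of x] by linarith
  qed
qed (use assms in simp)

lemma dnorm_nonneg: "\<phi> \<in> udual \<Longrightarrow> 0 \<le> dnorm \<phi>"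
  using dnorm_upper[of \<phi> 0] by (simp add: udual_zero)

lemma dnorm_bound:
  assumes \<phi>: "\<phi> \<in> udual"
  shows "cmod (\<phi> x) \<le> dnorm \<phi> * unorm x"
proof (cases "unorm x = 0")
  \<comment> \<open>The seminorm can vanish on nonzero pairs, which cannot be normalized; there any
    bounding constant already gives \<phi>(x) = 0.\<close>
  case True
  obtain K where "cmod (\<phi> x) \<le> K * unorm x" using \<phi> unfolding udual_def by blast
  with True show ?thesis by simp
next
  case False
  then have pos: "0 < unorm x" using unorm_nonneg[of x] by linarith
  have "unorm (uscale (complex_of_real (1 / unorm x)) x) \<le> cmod (complex_of_real (1 / unorm x)) * unorm x"
    by (rule unorm_uscale_le)
  also have "\<dots> = 1" unfolding norm_of_real using pos by simp
  finally have "cmod (\<phi> (uscale (complex_of_real (1 / unorm x)) x)) \<le> dnorm \<phi>"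
    by (rule dnorm_upper[OF \<phi>])
  then show ?thesis
    unfolding udual_uscale[OF \<phi>] norm_mult norm_of_real using pos by (simp add: field_simps)
qed

lemma udual_plus: "\<phi> \<in> udual \<Longrightarrow> \<psi> \<in> udual \<Longrightarrow> (\<lambda>x. \<phi> x + \<psi> x) \<in> udual"
proof (rule udualI)
  fix x assume a: "\<phi> \<in> udual" "\<psi> \<in> udual"
  show "cmod (\<phi> x + \<psi> x) \<le> (dnorm \<phi> + dnorm \<psi>) * unorm x"
    using dnorm_bound[OF a(1), of x] dnorm_bound[OF a(2), of x] norm_triangle_ineq[of "\<phi> x" "\<psi> x"]
    by (simp add: distrib_right)
qed (simp_all add: udual_add udual_uscale distrib_left)

lemma udual_times: "\<phi> \<in> udual \<Longrightarrow> (\<lambda>x. c * \<phi> x) \<in> udual"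
proof (rule udualI)
  fix x assume a: "\<phi> \<in> udual"
  show "cmod (c * \<phi> x) \<le> (cmod c * dnorm \<phi>) * unorm x"
    using dnorm_bound[OF a, of x] by (simp add: norm_mult mult.assoc mult_left_mono)
qed (simp_all add: udual_add udual_uscale distrib_left)

lemma udual_minus: "\<phi> \<in> udual \<Longrightarrow> \<psi> \<in> udual \<Longrightarrow> (\<lambda>x. \<phi> x - \<psi> x) \<in> udual"
  using udual_plus[of \<phi> "\<lambda>x. (-1) * \<psi> x"] udual_times[of \<psi> "-1"] by simp

lemma udual_null: "(\<lambda>x. 0) \<in> udual"
  by (rule udualI[where K = 0]) auto

text \<open>This is x.\<phi>, the inner functional of the second Arens product.\<close>

lemma udual_shift: "\<phi> \<in> udual \<Longrightarrow> (\<lambda>y. \<phi> (umult y x)) \<in> udual"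
  and dnorm_shift_le: "\<phi> \<in> udual \<Longrightarrow> dnorm (\<lambda>y. \<phi> (umult y x)) \<le> dnorm \<phi> * unorm x"
proof -
  assume \<phi>: "\<phi> \<in> udual"
  have b: "cmod (\<phi> (umult y x)) \<le> (dnorm \<phi> * unorm x) * unorm y" for y
  proof -
    have "cmod (\<phi> (umult y x)) \<le> dnorm \<phi> * unorm (umult y x)" by (rule dnorm_bound[OF \<phi>])
    also have "\<dots> \<le> dnorm \<phi> * (unorm y * unorm x)"
      by (intro mult_left_mono unorm_umult dnorm_nonneg \<phi>)
    finally show ?thesis by (simp add: mult_ac)
  qed
  show "(\<lambda>y. \<phi> (umult y x)) \<in> udual"
    by (rule udualI[OF _ _ b]) (simp_all add: umult_add_left umult_uscale_left udual_add[OF \<phi>]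
        udual_uscale[OF \<phi>])
  show "dnorm (\<lambda>y. \<phi> (umult y x)) \<le> dnorm \<phi> * unorm x"
    by (rule dnorm_le[OF _ b]) (simp add: dnorm_nonneg[OF \<phi>])
qed

text \<open>Apply \<open>sublinear_dominates_linear\<close> to the distance to \<open>J\<close>, and complexify.\<close>

lemma udual_separates:
  fixes J :: "'a::complex_banach_algebra set"
  assumes au: "approx_unital TYPE('a)" and J: "csubspace J" "closed J" and a: "a \<notin> J"
  shows "\<exists>\<phi>\<in>udual. (\<forall>j\<in>J. \<phi> (inA j) = 0) \<and> \<phi> (inA a) \<noteq> 0"
proof -
  have J0: "0 \<in> J" and Jadd: "\<And>x y. x \<in> J \<Longrightarrow> y \<in> J \<Longrightarrow> x + y \<in> J"
    and Jsc: "\<And>c x. x \<in> J \<Longrightarrow> scaleC c x \<in> J"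
    using J(1) by (auto simp: csubspace_def)
  define d where "d x = (INF j\<in>J. unorm (x - inA j))" for x :: "'a unit_el"
  have bdd: "bdd_below ((\<lambda>j. unorm (x - inA j)) ` J)" for x
    by (rule bdd_belowI2[of _ 0]) simp
  have d_le: "d x \<le> unorm (x - inA j)" if "j \<in> J" for x j
    unfolding d_def by (rule cINF_lower[OF bdd that])
  have d_ge: "b \<le> d x" if "\<And>j. j \<in> J \<Longrightarrow> b \<le> unorm (x - inA j)" for b x
    unfolding d_def by (rule cINF_greatest) (use J0 that in auto)
  have d_nonneg: "0 \<le> d x" for x by (rule d_ge) simp
  have dJ: "d (inA j) = 0" if "j \<in> J" for j
    using d_le[OF that, of "inA j"] d_nonneg[of "inA j"] by simp
  have "sublinear d"
  proof (rule sublinearI)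
    fix x y
    have *: "d (x + y) \<le> unorm (x - inA i) + unorm (y - inA j)" if "i \<in> J" "j \<in> J" for i j
    proof -
      have "x + y - inA (i + j) = (x - inA i) + (y - inA j)" by (simp add: inA_add)
      then show ?thesis
        using d_le[OF Jadd[OF that], of "x + y"] unorm_add[of "x - inA i" "y - inA j"]
        by (metis order_trans)
    qed
    have "d (x + y) - unorm (x - inA i) \<le> d y" if "i \<in> J" for i
      using *[OF that] by (intro d_ge) (simp add: algebra_simps)
    then have "d (x + y) - d y \<le> d x" by (intro d_ge) (simp add: algebra_simps)
    then show "d (x + y) \<le> d x + d y" by simp
  next
    show "d 0 = 0" using dJ[OF J0] by (simp add: inA_zero)
  next
    fix r :: real and x
    assume r: "0 < r"
    have "d (r *\<^sub>R x) / r \<le> d x"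
    proof (rule d_ge)
      fix j assume j: "j \<in> J"
      have "d (r *\<^sub>R x) \<le> unorm (r *\<^sub>R x - inA (scaleC (complex_of_real r) j))"
        by (intro d_le Jsc j)
      also have "r *\<^sub>R x - inA (scaleC (complex_of_real r) j) = uscale (complex_of_real r) (x - inA j)"
        by (simp add: inA_scaleC uscale_of_real scaleR_diff_right)
      also have "unorm \<dots> \<le> r * unorm (x - inA j)"
        using unorm_uscale_le[of "complex_of_real r" "x - inA j"] r by simp
      finally show "d (r *\<^sub>R x) / r \<le> unorm (x - inA j)" using r by (simp add: field_simps)
    qed
    then show "d (r *\<^sub>R x) \<le> r * d x" using r by (simp add: field_simps)
  qed
  then obtain f where f: "linear f" "\<And>x. f x \<le> d x" "f (inA a) = d (inA a)"
    using sublinear_dominates_linear[of d "inA a"] by blast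
  note lin = linear_add[OF f(1)] linear_scale[OF f(1)] linear_neg[OF f(1)] linear_diff[OF f(1)]
  have d_unorm: "d x \<le> unorm x" for x using d_le[OF J0, of x] by (simp add: inA_zero)
  have unorm_neg: "unorm (- x) \<le> unorm x" for x :: "'a unit_el"
    using unorm_uscale_le[of "-1" x] by (simp add: uscale_minus_left)
  have f_abs: "\<bar>f x\<bar> \<le> unorm x" for x
    using f(2)[of x] f(2)[of "- x"] d_unorm[of x] d_unorm[of "- x"] unorm_neg[of x]
    by (simp add: lin abs_le_iff)
  have fJ: "f (inA j) = 0" if "j \<in> J" for j
  proof -
    have "- j \<in> J" using Jsc[OF that, of "-1"] by (simp add: scaleC_one)
    moreover have "inA (- j) = - inA j" using inA_diff[of 0 j] by (simp add: inA_zero)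
    ultimately have "f (- inA j) \<le> 0" "f (inA j) \<le> 0"
      using f(2)[of "inA (- j)"] f(2)[of "inA j"] dJ[of j] dJ[of "- j"] that by simp_all
    then show ?thesis by (simp add: lin)
  qed
  define \<phi> where "\<phi> x = Complex (f x) (- f (uscale \<i> x))" for x
  have "\<phi> \<in> udual"
  proof (rule udualI)
    fix x y c
    show "\<phi> (x + y) = \<phi> x + \<phi> y"
      by (simp add: \<phi>_def complex_eq_iff uscale_add_right lin)
    have split: "uscale c x = Re c *\<^sub>R x + Im c *\<^sub>R uscale \<i> x" for c and x :: "'a unit_el"
    proof -
      have "uscale c x = uscale (complex_of_real (Re c) + complex_of_real (Im c) * \<i>) x"
        by (simp add: complex_eq mult.commute flip: complex_eq)
      then show ?thesis by (simp add: uscale_add_left uscale_of_real flip: uscale_uscale)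
    qed
    have "f (uscale c x) = Re c * f x + Im c * f (uscale \<i> x)"
      unfolding split[of c x] by (simp add: lin)
    moreover have "f (uscale \<i> (uscale c x)) = - Im c * f x + Re c * f (uscale \<i> x)"
      unfolding uscale_uscale split[of "\<i> * c" x] by (simp add: lin)
    ultimately show "\<phi> (uscale c x) = c * \<phi> x"
      by (simp add: \<phi>_def complex_eq_iff algebra_simps)
    \<comment> \<open>Adding the bounds for real and imaginary part costs a factor 2;
      \<open>udual\<close> only asks for some constant.\<close>
    have "cmod (\<phi> x) \<le> \<bar>f x\<bar> + \<bar>f (uscale \<i> x)\<bar>"
      using cmod_le[of "\<phi> x"] by (simp add: \<phi>_def)
    also have "\<dots> \<le> unorm x + unorm x"
      using f_abs[of x] f_abs[of "uscale \<i> x"] unorm_uscale_le[of \<i> x] by simp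
    finally show "cmod (\<phi> x) \<le> 2 * unorm x" by simp
  qed
  moreover have "\<phi> (inA j) = 0" if "j \<in> J" for j
    using fJ[OF that] fJ[OF Jsc[OF that, of \<i>]] by (simp add: \<phi>_def inA_scaleC complex_eq_iff)
  moreover have "\<phi> (inA a) \<noteq> 0"
  proof -
    \<comment> \<open>Closedness of J gives a gap in the norm of \<open>A\<close>;
      \<open>unorm_inA\<close> turns it into a positive lower bound for d.\<close>
    have "open (- J)" "a \<in> - J" using J(2) a by auto
    then obtain e where e: "e > 0" "ball a e \<subseteq> - J" by (rule openE)
    have "e \<le> d (inA a)"
    proof (rule d_ge)
      fix j assume "j \<in> J"
      then have "e \<le> dist a j" using e by (force simp: not_less[symmetric])
      then show "e \<le> unorm (inA a - inA j)" by (simp add: dist_norm unorm_inA[OF au] flip: inA_diff)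
    qed
    then show ?thesis using e f(3) by (auto simp: \<phi>_def complex_eq_iff)
  qed
  ultimately show ?thesis by blast
qed

section \<open>The bidual as a Banach algebra\<close>

lemma Nsp_plus: "\<Phi> \<in> Nsp \<Longrightarrow> \<phi> \<in> udual \<Longrightarrow> \<psi> \<in> udual \<Longrightarrow> \<Phi> (\<lambda>x. \<phi> x + \<psi> x) = \<Phi> \<phi> + \<Phi> \<psi>"
  and Nsp_times: "\<Phi> \<in> Nsp \<Longrightarrow> \<phi> \<in> udual \<Longrightarrow> \<Phi> (\<lambda>x. c * \<phi> x) = c * \<Phi> \<phi>"
  and Nsp_outside: "\<Phi> \<in> Nsp \<Longrightarrow> \<phi> \<notin> udual \<Longrightarrow> \<Phi> \<phi> = 0"
  unfolding Nsp_def by blast+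

lemma NspI:
  assumes "\<And>\<phi> \<psi>. \<phi> \<in> udual \<Longrightarrow> \<psi> \<in> udual \<Longrightarrow> \<Phi> (\<lambda>x. \<phi> x + \<psi> x) = \<Phi> \<phi> + \<Phi> \<psi>"
    "\<And>\<phi> c. \<phi> \<in> udual \<Longrightarrow> \<Phi> (\<lambda>x. c * \<phi> x) = c * \<Phi> \<phi>"
    "\<And>\<phi>. \<phi> \<in> udual \<Longrightarrow> cmod (\<Phi> \<phi>) \<le> K * dnorm \<phi>"
    "\<And>\<phi>. \<phi> \<notin> udual \<Longrightarrow> \<Phi> \<phi> = 0"
  shows "\<Phi> \<in> Nsp"
  using assms unfolding Nsp_def by blast

lemma bnorm_le:
  assumes "0 \<le> K" "\<And>\<phi>. \<phi> \<in> udual \<Longrightarrow> cmod (\<Phi> \<phi>) \<le> K * dnorm \<phi>"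
  shows "bnorm \<Phi> \<le> K"
  unfolding bnorm_def
proof (rule cSUP_least)
  have "(\<lambda>x. 0) \<in> {\<phi> \<in> udual. dnorm \<phi> \<le> 1}"
    using dnorm_le[of 1 "\<lambda>x. 0"] by (simp add: udual_null)
  then show "{\<phi> \<in> udual. dnorm \<phi> \<le> 1} \<noteq> {}" by blast
  fix \<phi> :: "'a dual_el" assume \<phi>: "\<phi> \<in> {\<phi> \<in> udual. dnorm \<phi> \<le> 1}"
  then have "K * dnorm \<phi> \<le> K" using assms(1) by (simp add: mult_left_le dnorm_nonneg)
  then show "cmod (\<Phi> \<phi>) \<le> K" using assms(2)[of \<phi>] \<phi> by simp
qed

lemma bnorm_upper:
  assumes \<Phi>: "\<Phi> \<in> Nsp" and "\<phi> \<in> udual" "dnorm \<phi> \<le> 1"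
  shows "cmod (\<Phi> \<phi>) \<le> bnorm \<Phi>"
  unfolding bnorm_def
proof (rule cSUP_upper)
  obtain K where K: "\<And>\<phi>. \<phi> \<in> udual \<Longrightarrow> cmod (\<Phi> \<phi>) \<le> K * dnorm \<phi>" using \<Phi> unfolding Nsp_def by blast
  show "bdd_above ((\<lambda>\<phi>. cmod (\<Phi> \<phi>)) ` {\<phi> \<in> udual. dnorm \<phi> \<le> 1})"
  proof (rule bdd_aboveI2)
    fix \<phi> :: "'a dual_el" assume \<phi>: "\<phi> \<in> {\<phi> \<in> udual. dnorm \<phi> \<le> 1}"
    then have "\<bar>K\<bar> * dnorm \<phi> \<le> \<bar>K\<bar>" by (simp add: mult_left_le dnorm_nonneg)
    moreover have "K * dnorm \<phi> \<le> \<bar>K\<bar> * dnorm \<phi>" using \<phi> by (intro mult_right_mono dnorm_nonneg) auto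
    ultimately show "cmod (\<Phi> \<phi>) \<le> \<bar>K\<bar>" using K[of \<phi>] \<phi> by auto
  qed
qed (use assms in simp)

lemma Nsp_null: "\<Phi> \<in> Nsp \<Longrightarrow> \<Phi> (\<lambda>x. 0) = 0"
  using Nsp_times[of \<Phi> "\<lambda>x. 0" 0] by (simp add: udual_null)

lemma bnorm_nonneg: "\<Phi> \<in> Nsp \<Longrightarrow> 0 \<le> bnorm \<Phi>"
  using bnorm_upper[of \<Phi> "\<lambda>x. 0"] dnorm_le[of 1 "\<lambda>x. 0"] by (simp add: udual_null Nsp_null)

lemma dnorm_times_le:
  assumes "\<phi> \<in> udual"
  shows "dnorm (\<lambda>x. c * \<phi> x) \<le> cmod c * dnorm \<phi>"
  using dnorm_bound[OF assms]
  by (intro dnorm_le) (simp_all add: dnorm_nonneg[OF assms] norm_mult mult.assoc mult_left_mono)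

lemma bnorm_bound:
  assumes \<Phi>: "\<Phi> \<in> Nsp" and \<phi>: "\<phi> \<in> udual"
  shows "cmod (\<Phi> \<phi>) \<le> bnorm \<Phi> * dnorm \<phi>"
proof (cases "dnorm \<phi> = 0")
  case True
  obtain K where "cmod (\<Phi> \<phi>) \<le> K * dnorm \<phi>" using \<Phi> \<phi> unfolding Nsp_def by blast
  with True show ?thesis by simp
next
  case False
  then have pos: "0 < dnorm \<phi>" using dnorm_nonneg[OF \<phi>] by linarith
  define c where "c = complex_of_real (1 / dnorm \<phi>)"
  have c: "cmod c = 1 / dnorm \<phi>" using pos unfolding c_def norm_of_real by simp
  have "dnorm (\<lambda>x. c * \<phi> x) \<le> cmod c * dnorm \<phi>" by (rule dnorm_times_le[OF \<phi>])
  also have "\<dots> = 1" using pos by (simp add: c)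
  finally have "cmod (\<Phi> (\<lambda>x. c * \<phi> x)) \<le> bnorm \<Phi>"
    by (rule bnorm_upper[OF \<Phi> udual_times[OF \<phi>]])
  then show ?thesis
    using pos by (simp add: Nsp_times[OF \<Phi> \<phi>] norm_mult c field_simps)
qed

lemma Nsp_zero: "(\<lambda>\<phi>. 0) \<in> Nsp"
  by (rule NspI[where K = 0]) simp_all

text \<open>As a type, \<open>N\<close> can be an instance of \<open>complex_banach_algebra\<close>,
  and the results on M-projections apply to it directly.\<close>

typedef (overloaded) 'a bidual = "Nsp :: 'a::complex_banach_algebra bidual_el set"
  morphisms ev Bidual
  using Nsp_zero by blast

lemma ev_plus_right: "\<phi> \<in> udual \<Longrightarrow> \<psi> \<in> udual \<Longrightarrow> ev \<Phi> (\<lambda>x. \<phi> x + \<psi> x) = ev \<Phi> \<phi> + ev \<Phi> \<psi>"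
  and ev_times_right: "\<phi> \<in> udual \<Longrightarrow> ev \<Phi> (\<lambda>x. c * \<phi> x) = c * ev \<Phi> \<phi>"
  and ev_outside: "\<phi> \<notin> udual \<Longrightarrow> ev \<Phi> \<phi> = 0"
  using ev[of \<Phi>] by (simp_all add: Nsp_plus Nsp_times Nsp_outside)

lemma ev_minus_right: "\<phi> \<in> udual \<Longrightarrow> \<psi> \<in> udual \<Longrightarrow> ev \<Phi> (\<lambda>x. \<phi> x - \<psi> x) = ev \<Phi> \<phi> - ev \<Phi> \<psi>"
  using ev_plus_right[of \<phi> "\<lambda>x. (-1) * \<psi> x" \<Phi>] ev_times_right[of \<psi> \<Phi> "-1"] udual_times[of \<psi> "-1"] by simp

text \<open>The convention that elements of \<open>Nsp\<close> are 0 outside \<open>udual\<close>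
  makes agreement on \<open>udual\<close> sufficient.\<close>

lemma bidual_eqI: "(\<And>\<phi>. \<phi> \<in> udual \<Longrightarrow> ev \<Phi> \<phi> = ev \<Psi> \<phi>) \<Longrightarrow> \<Phi> = \<Psi>"
  by (metis ev_inject ev_outside ext)

lemma badd_Nsp: "\<Phi> \<in> Nsp \<Longrightarrow> \<Psi> \<in> Nsp \<Longrightarrow> badd \<Phi> \<Psi> \<in> Nsp"
proof (rule NspI)
  fix \<phi> :: "'a dual_el" assume a: "\<Phi> \<in> Nsp" "\<Psi> \<in> Nsp" "\<phi> \<in> udual"
  show "cmod (badd \<Phi> \<Psi> \<phi>) \<le> (bnorm \<Phi> + bnorm \<Psi>) * dnorm \<phi>"
    using bnorm_bound[OF a(1,3)] bnorm_bound[OF a(2,3)] norm_triangle_ineq[of "\<Phi> \<phi>" "\<Psi> \<phi>"]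
    by (simp add: badd_def distrib_right)
qed (simp_all add: badd_def Nsp_plus Nsp_times Nsp_outside distrib_left)

lemma bscale_Nsp: "\<Phi> \<in> Nsp \<Longrightarrow> bscale c \<Phi> \<in> Nsp"
proof (rule NspI)
  fix \<phi> :: "'a dual_el" assume a: "\<Phi> \<in> Nsp" "\<phi> \<in> udual"
  show "cmod (bscale c \<Phi> \<phi>) \<le> (cmod c * bnorm \<Phi>) * dnorm \<phi>"
    using bnorm_bound[OF a] by (simp add: bscale_def norm_mult mult.assoc mult_left_mono)
qed (simp_all add: bscale_def Nsp_plus Nsp_times Nsp_outside distrib_left)

text \<open>This is \<phi>.\<Phi>. Its norm bound, followed by that of the outer factor, gives
  submultiplicativity of the Arens product.\<close>

lemma Arens_functional:
  assumes \<Phi>: "\<Phi> \<in> Nsp" and \<phi>: "\<phi> \<in> udual"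
  shows "(\<lambda>x. \<Phi> (\<lambda>y. \<phi> (umult y x))) \<in> udual"
    and "dnorm (\<lambda>x. \<Phi> (\<lambda>y. \<phi> (umult y x))) \<le> bnorm \<Phi> * dnorm \<phi>"
proof -
  have b: "cmod (\<Phi> (\<lambda>y. \<phi> (umult y x))) \<le> (bnorm \<Phi> * dnorm \<phi>) * unorm x" for x
  proof -
    have "cmod (\<Phi> (\<lambda>y. \<phi> (umult y x))) \<le> bnorm \<Phi> * dnorm (\<lambda>y. \<phi> (umult y x))"
      by (rule bnorm_bound[OF \<Phi> udual_shift[OF \<phi>]])
    also have "\<dots> \<le> bnorm \<Phi> * (dnorm \<phi> * unorm x)"
      by (intro mult_left_mono dnorm_shift_le \<phi> bnorm_nonneg \<Phi>)
    finally show ?thesis by (simp add: mult.assoc)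
  qed
  show "(\<lambda>x. \<Phi> (\<lambda>y. \<phi> (umult y x))) \<in> udual"
    by (rule udualI[OF _ _ b])
      (simp_all add: umult_add_right umult_uscale_right udual_add[OF \<phi>] udual_uscale[OF \<phi>]
        Nsp_plus[OF \<Phi> udual_shift[OF \<phi>] udual_shift[OF \<phi>]] Nsp_times[OF \<Phi> udual_shift[OF \<phi>]])
  show "dnorm (\<lambda>x. \<Phi> (\<lambda>y. \<phi> (umult y x))) \<le> bnorm \<Phi> * dnorm \<phi>"
    by (rule dnorm_le[OF _ b]) (simp add: bnorm_nonneg[OF \<Phi>] dnorm_nonneg[OF \<phi>])
qed

lemma arens2_bound:
  assumes "\<Phi> \<in> Nsp" "\<Psi> \<in> Nsp" "\<phi> \<in> udual"
  shows "cmod (arens2 \<Phi> \<Psi> \<phi>) \<le> (bnorm \<Phi> * bnorm \<Psi>) * dnorm \<phi>"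
proof -
  have "cmod (arens2 \<Phi> \<Psi> \<phi>) \<le> bnorm \<Psi> * dnorm (\<lambda>x. \<Phi> (\<lambda>y. \<phi> (umult y x)))"
    using bnorm_bound[OF assms(2) Arens_functional(1)[OF assms(1,3)]] assms(3)
    by (simp add: arens2_def)
  also have "\<dots> \<le> bnorm \<Psi> * (bnorm \<Phi> * dnorm \<phi>)"
    by (intro mult_left_mono Arens_functional(2) bnorm_nonneg assms)
  finally show ?thesis by (simp add: mult_ac)
qed

lemma arens2_Nsp: "\<Phi> \<in> Nsp \<Longrightarrow> \<Psi> \<in> Nsp \<Longrightarrow> arens2 \<Phi> \<Psi> \<in> Nsp"
proof (rule NspI)
  fix \<phi> \<psi> :: "'a dual_el" and c assume a: "\<Phi> \<in> Nsp" "\<Psi> \<in> Nsp" "\<phi> \<in> udual"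
  show "cmod (arens2 \<Phi> \<Psi> \<phi>) \<le> (bnorm \<Phi> * bnorm \<Psi>) * dnorm \<phi>" by (rule arens2_bound[OF a])
  show "arens2 \<Phi> \<Psi> (\<lambda>x. c * \<phi> x) = c * arens2 \<Phi> \<Psi> \<phi>"
    by (simp add: arens2_def udual_times a(3) Nsp_times[OF a(1) udual_shift[OF a(3)]]
        Nsp_times[OF a(2) Arens_functional(1)[OF a(1,3)]])
  assume \<psi>: "\<psi> \<in> udual"
  show "arens2 \<Phi> \<Psi> (\<lambda>x. \<phi> x + \<psi> x) = arens2 \<Phi> \<Psi> \<phi> + arens2 \<Phi> \<Psi> \<psi>"
    by (simp add: arens2_def udual_plus a(3) \<psi> Nsp_plus[OF a(1) udual_shift[OF a(3)] udual_shift[OF \<psi>]]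
        Nsp_plus[OF a(2) Arens_functional(1)[OF a(1,3)] Arens_functional(1)[OF a(1) \<psi>]])
qed (simp add: arens2_def)

lemma emb_Nsp: "emb x \<in> Nsp"
proof (rule NspI)
  fix \<phi> :: "'a dual_el" assume "\<phi> \<in> udual"
  then show "cmod (emb x \<phi>) \<le> unorm x * dnorm \<phi>"
    using dnorm_bound[of \<phi> x] by (simp add: emb_def mult.commute)
qed (simp_all add: emb_def udual_plus udual_times)

section \<open>Norm, product and completeness of the bidual\<close>

instantiation bidual :: (complex_banach_algebra) real_normed_vector
begin

definition "0 = Bidual (\<lambda>\<phi>. 0)"
definition "\<Phi> + \<Psi> = Bidual (badd (ev \<Phi>) (ev \<Psi>))"
definition "- \<Phi> = Bidual (bscale (-1) (ev \<Phi>))"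
definition "\<Phi> - \<Psi> = Bidual (badd (ev \<Phi>) (bscale (-1) (ev \<Psi>)))"
definition "r *\<^sub>R \<Phi> = Bidual (bscale (complex_of_real r) (ev \<Phi>))"
definition "norm \<Phi> = bnorm (ev \<Phi>)"
definition "dist \<Phi> \<Psi> = norm (\<Phi> - \<Psi> :: 'a bidual)"
definition "sgn \<Phi> = inverse (norm \<Phi>) *\<^sub>R (\<Phi> :: 'a bidual)"
definition "(uniformity :: ('a bidual \<times> 'a bidual) filter) = (INF e\<in>{0<..}. principal {(x, y). dist x y < e})"
definition "open (U :: 'a bidual set) \<longleftrightarrow> (\<forall>x\<in>U. eventually (\<lambda>(x', y). x' = x \<longrightarrow> y \<in> U) uniformity)"

lemma ev_zero: "ev 0 \<phi> = 0"
  by (simp add: zero_bidual_def Bidual_inverse Nsp_zero)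

lemma ev_add: "ev (\<Phi> + \<Psi>) = badd (ev \<Phi>) (ev \<Psi>)"
  by (simp add: plus_bidual_def Bidual_inverse badd_Nsp ev)

lemma ev_uminus: "ev (- \<Phi>) = bscale (-1) (ev \<Phi>)"
  by (simp add: uminus_bidual_def Bidual_inverse bscale_Nsp ev)

lemma ev_diff: "ev (\<Phi> - \<Psi>) = badd (ev \<Phi>) (bscale (-1) (ev \<Psi>))"
  by (simp add: minus_bidual_def Bidual_inverse badd_Nsp bscale_Nsp ev)

lemma ev_scaleR: "ev (r *\<^sub>R \<Phi>) = bscale (complex_of_real r) (ev \<Phi>)"
  by (simp add: scaleR_bidual_def Bidual_inverse bscale_Nsp ev)

lemmas ev_linear = ev_zero ev_add ev_uminus ev_diff ev_scaleR badd_def bscale_def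

lemma ev_norm_bound: "\<phi> \<in> udual \<Longrightarrow> cmod (ev \<Phi> \<phi>) \<le> norm \<Phi> * dnorm \<phi>"
  using bnorm_bound[OF ev] by (simp add: norm_bidual_def)

lemma bidual_norm_le:
  "0 \<le> K \<Longrightarrow> (\<And>\<phi>. \<phi> \<in> udual \<Longrightarrow> cmod (ev \<Phi> \<phi>) \<le> K * dnorm \<phi>) \<Longrightarrow> norm \<Phi> \<le> K"
  unfolding norm_bidual_def by (rule bnorm_le)

lemma bidual_norm_nonneg: "0 \<le> norm (\<Phi> :: 'a bidual)"
  unfolding norm_bidual_def by (rule bnorm_nonneg[OF ev])

lemma bidual_norm_scaleR_le: "norm (r *\<^sub>R (\<Phi> :: 'a bidual)) \<le> \<bar>r\<bar> * norm \<Phi>"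
  using ev_norm_bound[of _ \<Phi>]
  by (intro bidual_norm_le)
    (simp_all add: ev_linear norm_mult mult.assoc mult_left_mono bidual_norm_nonneg)

instance
proof
  fix \<Phi> \<Psi> \<Theta> :: "'a bidual" and r s :: real
  show "\<Phi> + \<Psi> + \<Theta> = \<Phi> + (\<Psi> + \<Theta>)" "\<Phi> + \<Psi> = \<Psi> + \<Phi>" "0 + \<Phi> = \<Phi>" "- \<Phi> + \<Phi> = 0" "\<Phi> - \<Psi> = \<Phi> + - \<Psi>"
    "r *\<^sub>R (\<Phi> + \<Psi>) = r *\<^sub>R \<Phi> + r *\<^sub>R \<Psi>" "(r + s) *\<^sub>R \<Phi> = r *\<^sub>R \<Phi> + s *\<^sub>R \<Phi>" "r *\<^sub>R s *\<^sub>R \<Phi> = (r * s) *\<^sub>R \<Phi>"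
    "1 *\<^sub>R \<Phi> = \<Phi>"
    by (rule bidual_eqI, simp add: ev_linear algebra_simps)+
  show "dist \<Phi> \<Psi> = norm (\<Phi> - \<Psi>)" by (rule dist_bidual_def)
  show "sgn \<Phi> = inverse (norm \<Phi>) *\<^sub>R \<Phi>" by (rule sgn_bidual_def)
  show "uniformity = (INF e\<in>{0<..}. principal {(x::'a bidual, y). dist x y < e})"
    by (rule uniformity_bidual_def)
  show "open U \<longleftrightarrow> (\<forall>x\<in>U. eventually (\<lambda>(x', y). x' = x \<longrightarrow> y \<in> U) uniformity)" for U :: "'a bidual set"
    by (rule open_bidual_def)
  show "norm \<Phi> = 0 \<longleftrightarrow> \<Phi> = 0"
  proof
    assume "norm \<Phi> = 0"
    then show "\<Phi> = 0" using ev_norm_bound[of _ \<Phi>] by (intro bidual_eqI) (simp add: ev_zero)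
  next
    assume "\<Phi> = 0"
    then show "norm \<Phi> = 0"
      using bidual_norm_le[of 0 \<Phi>] bidual_norm_nonneg[of \<Phi>] by (simp add: ev_zero)
  qed
  show "norm (\<Phi> + \<Psi>) \<le> norm \<Phi> + norm \<Psi>"
  proof (rule bidual_norm_le)
    fix \<phi> :: "'a dual_el" assume "\<phi> \<in> udual"
    then show "cmod (ev (\<Phi> + \<Psi>) \<phi>) \<le> (norm \<Phi> + norm \<Psi>) * dnorm \<phi>"
      using ev_norm_bound[of \<phi> \<Phi>] ev_norm_bound[of \<phi> \<Psi>] norm_triangle_ineq[of "ev \<Phi> \<phi>" "ev \<Psi> \<phi>"]
      by (simp add: ev_linear distrib_right)
  qed (simp add: bidual_norm_nonneg)
  show "norm (r *\<^sub>R \<Phi>) = \<bar>r\<bar> * norm \<Phi>"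
  proof (cases "r = 0")
    case True
    then show ?thesis using bidual_norm_scaleR_le[of r \<Phi>] bidual_norm_nonneg[of "r *\<^sub>R \<Phi>"] by simp
  next
    case False
    have "\<Phi> = (1 / r) *\<^sub>R r *\<^sub>R \<Phi>" using False by (intro bidual_eqI) (simp add: ev_linear)
    then have "norm \<Phi> \<le> \<bar>1 / r\<bar> * norm (r *\<^sub>R \<Phi>)" by (metis bidual_norm_scaleR_le)
    then show ?thesis using bidual_norm_scaleR_le[of r \<Phi>] False by (simp add: field_simps)
  qed
qed

end

instantiation bidual :: (complex_banach_algebra) real_normed_algebra
begin

definition "\<Phi> * \<Psi> = Bidual (arens2 (ev \<Phi>) (ev \<Psi>))"

lemma ev_mult: "ev (\<Phi> * \<Psi>) = arens2 (ev \<Phi>) (ev \<Psi>)"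
  by (simp add: times_bidual_def Bidual_inverse arens2_Nsp ev)

lemma ev_mult_apply: "\<phi> \<in> udual \<Longrightarrow> ev (\<Phi> * \<Psi>) \<phi> = ev \<Psi> (\<lambda>x. ev \<Phi> (\<lambda>y. \<phi> (umult y x)))"
  by (simp add: ev_mult arens2_def)

lemma ev_functional: "\<phi> \<in> udual \<Longrightarrow> (\<lambda>x. ev \<Phi> (\<lambda>y. \<phi> (umult y x))) \<in> udual"
  by (rule Arens_functional(1)[OF ev])

instance
proof
  fix \<Phi> \<Psi> \<Theta> :: "'a bidual" and r :: real
  show "\<Phi> * \<Psi> * \<Theta> = \<Phi> * (\<Psi> * \<Theta>)"
    by (rule bidual_eqI) (simp add: ev_mult_apply ev_functional udual_shift umult_assoc)
  show "(\<Phi> + \<Psi>) * \<Theta> = \<Phi> * \<Theta> + \<Psi> * \<Theta>" "\<Phi> * (\<Psi> + \<Theta>) = \<Phi> * \<Psi> + \<Phi> * \<Theta>"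
    "r *\<^sub>R \<Phi> * \<Psi> = r *\<^sub>R (\<Phi> * \<Psi>)" "\<Phi> * r *\<^sub>R \<Psi> = r *\<^sub>R (\<Phi> * \<Psi>)"
    by (rule bidual_eqI, simp add: ev_mult_apply ev_linear ev_plus_right ev_times_right ev_functional)+
  show "norm (\<Phi> * \<Psi>) \<le> norm \<Phi> * norm \<Psi>"
    by (rule bidual_norm_le) (simp_all add: ev_mult norm_bidual_def arens2_bound ev bnorm_nonneg)
qed

end

text \<open>A Cauchy sequence converges at each functional; letting m tend to infinity in the Cauchy
  estimate makes the convergence uniform on the unit ball of the dual.\<close>

instance bidual :: (complex_banach_algebra) banach
proof
  fix X :: "nat \<Rightarrow> 'a bidual"
  assume X: "Cauchy X"
  have cau: "convergent (\<lambda>n. ev (X n) \<phi>)" if \<phi>: "\<phi> \<in> udual" for \<phi>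
  proof (intro Cauchy_convergent CauchyI)
    fix e :: real assume e: "0 < e"
    \<comment> \<open>The added 1 avoids dividing by zero when
      \<open>dnorm \<phi> = 0\<close>.\<close>
    define d where "d = dnorm \<phi> + 1"
    have d: "d > 0" "dnorm \<phi> \<le> d" using dnorm_nonneg[OF \<phi>] by (simp_all add: d_def)
    obtain M where M: "\<And>m n. m \<ge> M \<Longrightarrow> n \<ge> M \<Longrightarrow> norm (X m - X n) < e / d"
      using CauchyD[OF X, of "e / d"] e d by auto
    have "norm (ev (X m) \<phi> - ev (X n) \<phi>) < e" if "m \<ge> M" "n \<ge> M" for m n
    proof -
      have "norm (ev (X m) \<phi> - ev (X n) \<phi>) \<le> norm (X m - X n) * dnorm \<phi>"
        using ev_norm_bound[OF \<phi>, of "X m - X n"] by (simp add: ev_linear)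
      also have "\<dots> \<le> norm (X m - X n) * d" by (intro mult_left_mono d) simp
      also have "\<dots> < e" using M[OF that] d by (simp add: field_simps)
      finally show ?thesis .
    qed
    then show "\<exists>M. \<forall>m\<ge>M. \<forall>n\<ge>M. norm (ev (X m) \<phi> - ev (X n) \<phi>) < e" by blast
  qed
  define L where "L \<phi> = (if \<phi> \<in> udual then lim (\<lambda>n. ev (X n) \<phi>) else 0)" for \<phi>
  have lim: "(\<lambda>n. ev (X n) \<phi>) \<longlonglongrightarrow> L \<phi>" if "\<phi> \<in> udual" for \<phi>
    using cau[OF that] that by (simp add: L_def convergent_LIMSEQ_iff)
  obtain K where K: "\<And>n. norm (X n) \<le> K"
    using Cauchy_Bseq[OF X] by (auto simp: Bseq_def)
  have "L \<in> Nsp"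
  proof (rule NspI)
    fix \<phi> \<psi> :: "'a dual_el" and c assume \<phi>: "\<phi> \<in> udual"
    have "(\<lambda>n. ev (X n) (\<lambda>x. c * \<phi> x)) \<longlonglongrightarrow> c * L \<phi>"
      unfolding ev_times_right[OF \<phi>] by (intro tendsto_intros lim \<phi>)
    then show "L (\<lambda>x. c * \<phi> x) = c * L \<phi>" using lim[OF udual_times[OF \<phi>]] LIMSEQ_unique by blast
    show "cmod (L \<phi>) \<le> K * dnorm \<phi>"
    proof (rule LIMSEQ_le_const2[OF tendsto_norm[OF lim[OF \<phi>]]])
      have "cmod (ev (X n) \<phi>) \<le> K * dnorm \<phi>" for n
        using ev_norm_bound[OF \<phi>, of "X n"] mult_right_mono[OF K[of n] dnorm_nonneg[OF \<phi>]] by linarith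
      then show "\<exists>N. \<forall>n\<ge>N. cmod (ev (X n) \<phi>) \<le> K * dnorm \<phi>" by blast
    qed
    assume \<psi>: "\<psi> \<in> udual"
    have "(\<lambda>n. ev (X n) (\<lambda>x. \<phi> x + \<psi> x)) \<longlonglongrightarrow> L \<phi> + L \<psi>"
      unfolding ev_plus_right[OF \<phi> \<psi>] by (intro tendsto_intros lim \<phi> \<psi>)
    then show "L (\<lambda>x. \<phi> x + \<psi> x) = L \<phi> + L \<psi>"
      using lim[OF udual_plus[OF \<phi> \<psi>]] LIMSEQ_unique by blast
  qed (simp add: L_def)
  then have evL: "ev (Bidual L) = L" by (rule Bidual_inverse)
  have "X \<longlonglongrightarrow> Bidual L"
  proof (rule LIMSEQ_I)
    fix r :: real assume r: "0 < r"
    obtain M where M: "\<And>m n. m \<ge> M \<Longrightarrow> n \<ge> M \<Longrightarrow> norm (X m - X n) < r / 2"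
      using CauchyD[OF X, of "r / 2"] r by auto
    have "norm (X n - Bidual L) \<le> r / 2" if n: "n \<ge> M" for n
    proof (rule bidual_norm_le)
      fix \<phi> :: "'a dual_el" assume \<phi>: "\<phi> \<in> udual"
      have "(\<lambda>m. cmod (ev (X n) \<phi> - ev (X m) \<phi>)) \<longlonglongrightarrow> cmod (ev (X n) \<phi> - L \<phi>)"
        by (intro tendsto_intros lim \<phi>)
      moreover have "cmod (ev (X n) \<phi> - ev (X m) \<phi>) \<le> r / 2 * dnorm \<phi>" if "m \<ge> M" for m
        using ev_norm_bound[OF \<phi>, of "X n - X m"] 
          mult_right_mono[OF less_imp_le[OF M[OF n that]] dnorm_nonneg[OF \<phi>]]
        by (simp add: ev_linear)
      ultimately have "cmod (ev (X n) \<phi> - L \<phi>) \<le> r / 2 * dnorm \<phi>"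
        using LIMSEQ_le_const2 by blast
      then show "cmod (ev (X n - Bidual L) \<phi>) \<le> r / 2 * dnorm \<phi>"
        by (simp add: ev_diff evL badd_def bscale_def)
    qed (use r in simp)
    then show "\<exists>no. \<forall>n\<ge>no. norm (X n - Bidual L) < r"
      using r by (intro exI[of _ M]) (smt (verit) field_sum_of_halves)
  qed
  then show "convergent X" by (rule convergentI)
qed

instantiation bidual :: (complex_banach_algebra) complex_banach_algebra
begin

definition "scaleC c \<Phi> = Bidual (bscale c (ev \<Phi>))"

lemma ev_scaleC: "ev (scaleC c \<Phi>) = bscale c (ev \<Phi>)"
  by (simp add: scaleC_bidual_def Bidual_inverse bscale_Nsp ev)

lemma bidual_norm_scaleC_le: "norm (scaleC c (\<Phi> :: 'a bidual)) \<le> cmod c * norm \<Phi>"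
  using ev_norm_bound[of _ \<Phi>]
  by (intro bidual_norm_le) (simp_all add: ev_scaleC bscale_def norm_mult mult.assoc mult_left_mono)

instance
proof
  fix \<Phi> \<Psi> :: "'a bidual" and c d :: complex and r :: real
  show "scaleC c (\<Phi> + \<Psi>) = scaleC c \<Phi> + scaleC c \<Psi>" "scaleC (c + d) \<Phi> = scaleC c \<Phi> + scaleC d \<Phi>"
    "scaleC c (scaleC d \<Phi>) = scaleC (c * d) \<Phi>" "scaleC (complex_of_real r) \<Phi> = r *\<^sub>R \<Phi>"
    "scaleC c (\<Phi> * \<Psi>) = scaleC c \<Phi> * \<Psi>" "scaleC c (\<Phi> * \<Psi>) = \<Phi> * scaleC c \<Psi>"
    by (rule bidual_eqI, simp add: ev_scaleC ev_linear ev_mult_apply ev_times_right ev_functional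
        algebra_simps)+
  show one: "scaleC 1 \<Phi> = \<Phi>" for \<Phi> :: "'a bidual"
    by (rule bidual_eqI) (simp add: ev_scaleC bscale_def)
  show "norm (scaleC c \<Phi>) = cmod c * norm \<Phi>"
  proof (cases "c = 0")
    case True
    then show ?thesis using bidual_norm_scaleC_le[of c \<Phi>] by simp
  next
    case False
    have "\<Phi> = scaleC (1 / c) (scaleC c \<Phi>)" using False by (intro bidual_eqI) (simp add: ev_scaleC bscale_def)
    then have "norm \<Phi> \<le> cmod (1 / c) * norm (scaleC c \<Phi>)" by (metis bidual_norm_scaleC_le)
    then show ?thesis using bidual_norm_scaleC_le[of c \<Phi>] False by (simp add: field_simps norm_divide)
  qed
qed

end

section \<open>The canonical embedding and the unit\<close>

definition embed :: "'a::complex_banach_algebra unit_el \<Rightarrow> 'a bidual" where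
  "embed x = Bidual (emb x)"

lemma ev_embed_eq: "ev (embed x) = emb x"
  by (simp add: embed_def Bidual_inverse emb_Nsp)

lemma ev_embed: "\<phi> \<in> udual \<Longrightarrow> ev (embed x) \<phi> = \<phi> x"
  by (simp add: ev_embed_eq emb_def)

lemma norm_embed_le: "norm (embed x) \<le> unorm x"
  using dnorm_bound[of _ x] by (intro bidual_norm_le) (auto simp: ev_embed mult.commute)

text \<open>With an embedded right factor the product is weak*-continuous in the left factor as
  well: \<open>\<Phi>\<close> is evaluated at a functional that does not depend on it.\<close>

lemma ev_mult_embed: "\<phi> \<in> udual \<Longrightarrow> ev (\<Phi> * embed x) \<phi> = ev \<Phi> (\<lambda>y. \<phi> (umult y x))"
  by (simp add: ev_mult_apply ev_embed ev_functional)

lemma embed_mult: "embed x * embed y = embed (umult x y)"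
  by (rule bidual_eqI) (simp add: ev_mult_embed ev_embed udual_shift)

lemma contractive_unit_embed: "contractive_unit (embed (0, 1) :: 'a::complex_banach_algebra bidual)"
  unfolding contractive_unit_def
proof (intro conjI allI)
  fix \<Phi> :: "'a bidual"
  show "embed (0, 1) * \<Phi> = \<Phi>"
    by (rule bidual_eqI) (simp add: ev_mult_apply ev_embed udual_shift)
  show "\<Phi> * embed (0, 1) = \<Phi>"
    by (rule bidual_eqI) (simp add: ev_mult_embed)
  show "norm (embed (0, 1) :: 'a bidual) \<le> 1"
    using norm_embed_le unorm_one_le by (rule order_trans)
qed

section \<open>Suprema of directed sets\<close>

lemma unimodular_aligning: "\<exists>k. cmod k = 1 \<and> cmod (a + k * b) = cmod a + cmod b"
proof (cases "a = 0 \<or> b = 0")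
  case False
  define k where "k = sgn a / sgn b"
  have "a + k * b = sgn a * complex_of_real (cmod a + cmod b)"
    using False by (simp add: k_def sgn_eq field_simps)
  then have "cmod (a + k * b) = cmod a + cmod b"
    using False by (simp add: norm_mult norm_sgn del: of_real_add)
  moreover have "cmod k = 1" using False by (simp add: k_def norm_divide norm_sgn)
  ultimately show ?thesis by blast
qed (auto intro: exI[of _ 1])

lemma Mcentral_norm_mult_le: "Mcentral u \<Longrightarrow> norm (u * x) \<le> norm x"
  using Mcentral_norm[of u x 0] by simp

text \<open>If \<open>u\<Phi>\<close> almost attains the supremum of \<open>|(u\<Phi>)(\<phi>)|\<close> over \<open>u \<in> D\<close> and \<open>\<parallel>\<Phi>\<parallel> \<le> 1\<close>, then, as
\<open>u\<Phi> + (v - u)\<Psi> = v(u\<Phi> + (1 - u)\<Psi>)\<close>, there is little room left for \<open>((v - u)\<Psi>)(\<phi>)\<close>.\<close>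

lemma Mcentral_directed_Cauchy:
  fixes D :: "'a::complex_banach_algebra bidual set"
  assumes "D \<noteq> {}" and D: "\<And>u. u \<in> D \<Longrightarrow> Mcentral u" and \<phi>: "\<phi> \<in> udual" and \<epsilon>: "0 < \<epsilon>"
  shows "\<exists>u\<in>D. \<forall>v\<in>D. u * v = u \<longrightarrow> (\<forall>\<Psi>. cmod (ev (v * \<Psi>) \<phi> - ev (u * \<Psi>) \<phi>) \<le> \<epsilon> * norm \<Psi>)"
proof -
  define S where "S = {cmod (ev (u * \<Psi>) \<phi>) | u \<Psi>. u \<in> D \<and> norm \<Psi> \<le> 1}"
  obtain u0 where "u0 \<in> D" using assms(1) by blast
  then have "cmod (ev (u0 * 0) \<phi>) \<in> S"
    unfolding S_def by (intro CollectI exI[of _ u0] exI[of _ 0]) simp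
  then have S: "S \<noteq> {}" by blast
  have bdd: "bdd_above S"
  proof (rule bdd_aboveI)
    fix s assume "s \<in> S"
    then obtain u \<Psi> where s: "s = cmod (ev (u * \<Psi>) \<phi>)" and u: "u \<in> D" "norm \<Psi> \<le> 1" by (auto simp: S_def)
    have "s \<le> norm (u * \<Psi>) * dnorm \<phi>" unfolding s by (rule ev_norm_bound[OF \<phi>])
    also have "\<dots> \<le> 1 * dnorm \<phi>"
      using Mcentral_norm_mult_le[OF D[OF u(1)], of \<Psi>] u(2) by (intro mult_right_mono dnorm_nonneg \<phi>) simp
    finally show "s \<le> dnorm \<phi>" by simp
  qed
  obtain t where "t \<in> S" "Sup S - \<epsilon> < t" using less_cSupE[of "Sup S - \<epsilon>" S] S \<epsilon> by auto
  then obtain u \<Phi> where u: "u \<in> D" "norm \<Phi> \<le> 1" "Sup S - \<epsilon> < cmod (ev (u * \<Phi>) \<phi>)" by (auto simp: S_def)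
  have unit: "cmod (ev (v * \<Psi>) \<phi> - ev (u * \<Psi>) \<phi>) \<le> \<epsilon>" if v: "v \<in> D" "u * v = u" and \<Psi>: "norm \<Psi> \<le> 1" for v \<Psi>
  proof -
    \<comment> \<open>The phase k lets the increment from u to v add to the value at
      \<open>u * \<Phi>\<close> without cancellation. The total is at most \<open>Sup S\<close>,
      from which that value is less than \<epsilon> away.\<close>
    obtain k where k: "cmod k = 1" "cmod (ev (u * \<Phi>) \<phi> + k * (ev (v * \<Psi>) \<phi> - ev (u * \<Psi>) \<phi>))
        = cmod (ev (u * \<Phi>) \<phi>) + cmod (ev (v * \<Psi>) \<phi> - ev (u * \<Psi>) \<phi>)"
      using unimodular_aligning by blast
    define \<Theta> where "\<Theta> = u * \<Phi> + (scaleC k \<Psi> - u * scaleC k \<Psi>)"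
    have "norm \<Theta> \<le> max (norm \<Phi>) (norm (scaleC k \<Psi>))"
      unfolding \<Theta>_def by (rule Mcentral_norm[OF D[OF u(1)]])
    also have "\<dots> \<le> 1" using u(2) \<Psi> k(1) by (simp add: norm_scaleC)
    finally have "cmod (ev (v * \<Theta>) \<phi>) \<in> S" using v by (auto simp: S_def)
    then have "cmod (ev (v * \<Theta>) \<phi>) \<le> Sup S" using bdd by (rule cSup_upper)
    moreover have "v * u = u" using Mcentral_comm[OF D[OF v(1)], of u] v(2) by simp
    then have "v * \<Theta> = u * \<Phi> + scaleC k (v * \<Psi> - u * \<Psi>)"
      by (simp add: \<Theta>_def distrib_left right_diff_distrib scaleC_diff_right
          flip: mult.assoc scaleC_mult_right)
    then have "ev (v * \<Theta>) \<phi> = ev (u * \<Phi>) \<phi> + k * (ev (v * \<Psi>) \<phi> - ev (u * \<Psi>) \<phi>)"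
      by (simp add: ev_add ev_diff ev_scaleC badd_def bscale_def)
    ultimately show ?thesis using k(2) u(3) by simp
  qed
  have "cmod (ev (v * \<Psi>) \<phi> - ev (u * \<Psi>) \<phi>) \<le> \<epsilon> * norm \<Psi>" if v: "v \<in> D" "u * v = u" for v \<Psi>
  proof (cases "\<Psi> = 0")
    case False
    have "cmod (ev (v * ((1 / norm \<Psi>) *\<^sub>R \<Psi>)) \<phi> - ev (u * ((1 / norm \<Psi>) *\<^sub>R \<Psi>)) \<phi>) \<le> \<epsilon>"
      by (rule unit[OF v]) simp
    then have "cmod (complex_of_real (1 / norm \<Psi>) * (ev (v * \<Psi>) \<phi> - ev (u * \<Psi>) \<phi>)) \<le> \<epsilon>"
      by (simp add: ev_scaleR bscale_def right_diff_distrib)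
    then show ?thesis
      unfolding norm_mult norm_of_real using False by (simp add: field_simps)
  qed (simp add: ev_zero)
  then show ?thesis using u(1) by blast
qed

text \<open>The supremum is the weak* limit of \<open>D\<close>. The last clause says that a
  functional killed by all ranges of members of \<open>D\<close> is killed by the range of
  \<open>z\<close>; for closed spans it places \<open>zN\<close> inside
  \<open>J\<^sup>\<bottom>\<^sup>\<bottom>\<close>.\<close>

lemma Mcentral_directed_Sup:
  fixes D :: "'a::complex_banach_algebra bidual set"
  assumes ne: "D \<noteq> {}" and D: "\<And>u. u \<in> D \<Longrightarrow> Mcentral u"
    and dir: "\<And>u v. u \<in> D \<Longrightarrow> v \<in> D \<Longrightarrow> \<exists>w\<in>D. u * w = u \<and> v * w = v"
  shows "\<exists>z. Mcentral z \<and> (\<forall>u\<in>D. u * z = u) \<and> (\<forall>y. (\<forall>u\<in>D. u * y = u) \<longrightarrow> z * y = z) \<and>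
    (\<forall>\<phi>\<in>udual. (\<forall>u\<in>D. \<forall>\<Psi>. ev (u * \<Psi>) \<phi> = 0) \<longrightarrow> (\<forall>\<Psi>. ev (z * \<Psi>) \<phi> = 0))"
proof -
  \<comment> \<open>The filter of tails of \<open>D\<close> for the order u v = u, in place of a
    net.\<close>
  define F where "F = (INF u\<in>D. principal {v \<in> D. u * v = u})"
  have trans: "u * v = u" if "u * w = u" "w * v = w" for u v w :: "'a bidual"
    by (metis that mult.assoc)
  have evF: "eventually P F \<longleftrightarrow> (\<exists>u\<in>D. \<forall>v\<in>D. u * v = u \<longrightarrow> P v)" for P
    unfolding F_def
  proof (subst eventually_INF_base[OF ne])
    fix u v assume "u \<in> D" "v \<in> D"
    then obtain w where "w \<in> D" "u * w = u" "v * w = v" using dir by blast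
    then show "\<exists>w\<in>D. principal {x \<in> D. w * x = w} \<le> inf (principal {x \<in> D. u * x = u}) (principal {x \<in> D. v * x = v})"
      using trans by (auto intro!: bexI[of _ w])
  qed (auto simp: eventually_principal)
  have F: "F \<noteq> bot"
    unfolding trivial_limit_def evF using D Mcentral_idem by blast
  define e :: "'a bidual" where "e = embed (0, 1)"
  have e: "contractive_unit e" unfolding e_def by (rule contractive_unit_embed)
  have norm_D: "norm u \<le> 1" if "u \<in> D" for u
    using Mcentral_norm_mult_le[OF D[OF that], of e] e by (simp add: contractive_unit_def)
  have conv: "\<exists>l. ((\<lambda>v. ev v \<phi>) \<longlongrightarrow> l) F" if \<phi>: "\<phi> \<in> udual" for \<phi>
  proof -
    have "cauchy_filter (filtermap (\<lambda>v. ev v \<phi>) F)"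
      unfolding cauchy_filter_metric_filtermap
    proof (intro allI impI)
      fix r :: real assume r: "0 < r"
      obtain u where u: "u \<in> D" "\<And>v \<Psi>. v \<in> D \<Longrightarrow> u * v = u \<Longrightarrow> cmod (ev (v * \<Psi>) \<phi> - ev (u * \<Psi>) \<phi>) \<le> r / 3 * norm \<Psi>"
        using Mcentral_directed_Cauchy[OF ne D \<phi>, of "r / 3"] r by auto
      have "cmod (ev v \<phi> - ev u \<phi>) \<le> r / 3" if "v \<in> D" "u * v = u" for v
      proof -
        have "r / 3 * norm e \<le> r / 3" using e r by (simp add: contractive_unit_def)
        then show ?thesis using u(2)[OF that, of e] by (simp add: contractive_unit_mult[OF e])
      qed
      then have close: "dist (ev v \<phi>) (ev u \<phi>) \<le> r / 3" if "v \<in> D \<and> u * v = u" for v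
        using that by (simp add: dist_norm)
      have "dist (ev v \<phi>) (ev w \<phi>) < r" if "v \<in> D \<and> u * v = u" "w \<in> D \<and> u * w = u" for v w
        using close[OF that(1)] close[OF that(2)] r dist_triangle2[of "ev v \<phi>" "ev w \<phi>" "ev u \<phi>"]
        by linarith
      then show "\<exists>P. eventually P F \<and> (\<forall>v w. P v \<and> P w \<longrightarrow> dist (ev v \<phi>) (ev w \<phi>) < r)"
        using u(1) by (intro exI[of _ "\<lambda>v. v \<in> D \<and> u * v = u"]) (auto simp: evF)
    qed
    then show ?thesis
      using complete_UNIV[where 'a = complex] F unfolding complete_uniform
      by (force simp: filterlim_def filtermap_bot_iff)
  qed
  define L where "L \<phi> = (if \<phi> \<in> udual then SOME l. ((\<lambda>v. ev v \<phi>) \<longlongrightarrow> l) F else 0)" for \<phi>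
  have lim: "((\<lambda>v. ev v \<phi>) \<longlongrightarrow> L \<phi>) F" if "\<phi> \<in> udual" for \<phi>
    using someI_ex[OF conv[OF that]] that by (simp add: L_def)
  have in_D: "eventually (\<lambda>v. v \<in> D) F" using ne by (auto simp: evF)
  have "L \<in> Nsp"
  proof (rule NspI)
    fix \<phi> \<psi> :: "'a dual_el" and c assume \<phi>: "\<phi> \<in> udual"
    have "((\<lambda>v. ev v (\<lambda>x. c * \<phi> x)) \<longlongrightarrow> c * L \<phi>) F"
      unfolding ev_times_right[OF \<phi>] by (intro tendsto_intros lim \<phi>)
    then show "L (\<lambda>x. c * \<phi> x) = c * L \<phi>" using lim[OF udual_times[OF \<phi>]] F tendsto_unique by blast
    show "cmod (L \<phi>) \<le> 1 * dnorm \<phi>"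
    proof (rule tendsto_upperbound[OF tendsto_norm[OF lim[OF \<phi>]] _ F])
      show "\<forall>\<^sub>F v in F. cmod (ev v \<phi>) \<le> 1 * dnorm \<phi>"
        using in_D
      proof eventually_elim
        case (elim v)
        show ?case
          using ev_norm_bound[OF \<phi>, of v] mult_right_mono[OF norm_D[OF elim] dnorm_nonneg[OF \<phi>]] by linarith
      qed
    qed
    assume \<psi>: "\<psi> \<in> udual"
    have "((\<lambda>v. ev v (\<lambda>x. \<phi> x + \<psi> x)) \<longlongrightarrow> L \<phi> + L \<psi>) F"
      unfolding ev_plus_right[OF \<phi> \<psi>] by (intro tendsto_intros lim \<phi> \<psi>)
    then show "L (\<lambda>x. \<phi> x + \<psi> x) = L \<phi> + L \<psi>"
      using lim[OF udual_plus[OF \<phi> \<psi>]] F tendsto_unique by blast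
  qed (simp add: L_def)
  define z where "z = Bidual L"
  have evz: "ev z = L" unfolding z_def using \<open>L \<in> Nsp\<close> by (rule Bidual_inverse)
  \<comment> \<open>The continuous side: \<Psi> v at \<phi> is v evaluated at a fixed functional.
    Members of \<open>D\<close> commute with \<Psi>, so the limit can be read for v \<Psi>.\<close>
  have lim_right: "((\<lambda>v. ev (v * \<Psi>) \<phi>) \<longlongrightarrow> ev (\<Psi> * z) \<phi>) F" if \<phi>: "\<phi> \<in> udual" for \<phi> \<Psi>
  proof -
    have "((\<lambda>v. ev (\<Psi> * v) \<phi>) \<longlongrightarrow> ev (\<Psi> * z) \<phi>) F"
      unfolding ev_mult_apply[OF \<phi>] evz by (intro lim ev_functional \<phi>)
    moreover have "eventually (\<lambda>v. ev (\<Psi> * v) \<phi> = ev (v * \<Psi>) \<phi>) F"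
      using in_D by eventually_elim (metis D Mcentral_comm)
    ultimately show ?thesis by (rule Lim_transform_eventually)
  qed
  have zcomm: "z * \<Psi> = \<Psi> * z" for \<Psi>
  proof (rule bidual_eqI)
    fix \<phi> :: "'a dual_el" assume \<phi>: "\<phi> \<in> udual"
    \<comment> \<open>Both z \<Psi> and \<Psi> z are within r times the norm of \<Psi> of u \<Psi>:
      the second by passing to the limit in the Cauchy estimate, the first because \<phi>.u
      approximates \<phi>.z in the dual norm.\<close>
    have bound: "cmod (ev (z * \<Psi>) \<phi> - ev (\<Psi> * z) \<phi>) \<le> r * (2 * norm \<Psi>)" if r: "0 < r" for r
    proof -
      obtain u where u: "u \<in> D" "\<And>v \<Psi>. v \<in> D \<Longrightarrow> u * v = u \<Longrightarrow> cmod (ev (v * \<Psi>) \<phi> - ev (u * \<Psi>) \<phi>) \<le> r * norm \<Psi>"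
        using Mcentral_directed_Cauchy[OF ne D \<phi> r] by auto
      have limit: "cmod (ev (\<Psi> * z) \<phi> - ev (u * \<Psi>) \<phi>) \<le> r * norm \<Psi>" for \<Psi>
      proof (rule tendsto_upperbound[OF _ _ F])
        show "((\<lambda>v. cmod (ev (v * \<Psi>) \<phi> - ev (u * \<Psi>) \<phi>)) \<longlongrightarrow> cmod (ev (\<Psi> * z) \<phi> - ev (u * \<Psi>) \<phi>)) F"
          by (intro tendsto_intros lim_right \<phi>)
        show "\<forall>\<^sub>F v in F. cmod (ev (v * \<Psi>) \<phi> - ev (u * \<Psi>) \<phi>) \<le> r * norm \<Psi>"
          unfolding evF using u by blast
      qed
      \<comment> \<open>The functionals \<phi>.z and \<phi>.u. Their values at x are products with
        \<open>embed x\<close>, where left continuity holds, so the uniform Cauchy estimate bounds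
        the norm of their difference.\<close>
      let ?z = "\<lambda>x. ev z (\<lambda>y. \<phi> (umult y x))" and ?u = "\<lambda>x. ev u (\<lambda>y. \<phi> (umult y x))"
      have "dnorm (\<lambda>x. ?z x - ?u x) \<le> r"
      proof (rule dnorm_le)
        fix x
        have "((\<lambda>v. cmod (ev (v * embed x) \<phi> - ev (u * embed x) \<phi>)) \<longlongrightarrow> cmod (ev (z * embed x) \<phi> - ev (u * embed x) \<phi>)) F"
          unfolding ev_mult_embed[OF \<phi>] evz by (intro tendsto_intros lim udual_shift \<phi>)
        moreover have "\<forall>\<^sub>F v in F. cmod (ev (v * embed x) \<phi> - ev (u * embed x) \<phi>) \<le> r * norm (embed x)"
          unfolding evF using u by blast
        ultimately have "cmod (ev (z * embed x) \<phi> - ev (u * embed x) \<phi>) \<le> r * norm (embed x)"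
          by (rule tendsto_upperbound[OF _ _ F])
        also have "\<dots> \<le> r * unorm x" using r by (intro mult_left_mono norm_embed_le) simp
        finally show "cmod (?z x - ?u x) \<le> r * unorm x" by (simp add: ev_mult_embed[OF \<phi>])
      qed (use r in simp)
      then have "cmod (ev \<Psi> (\<lambda>x. ?z x - ?u x)) \<le> norm \<Psi> * r"
        using ev_norm_bound[OF udual_minus[OF ev_functional[OF \<phi>] ev_functional[OF \<phi>]], of \<Psi> z u]
          mult_left_mono[of "dnorm (\<lambda>x. ?z x - ?u x)" r "norm \<Psi>"] by simp
      then have "cmod (ev (z * \<Psi>) \<phi> - ev (u * \<Psi>) \<phi>) \<le> r * norm \<Psi>"
        by (simp add: ev_mult_apply[OF \<phi>] ev_minus_right ev_functional[OF \<phi>] mult.commute)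
      with limit[of \<Psi>] show ?thesis
        using norm_triangle_ineq4[of "ev (z * \<Psi>) \<phi> - ev (u * \<Psi>) \<phi>" "ev (\<Psi> * z) \<phi> - ev (u * \<Psi>) \<phi>"] by simp
    qed
    have "cmod (ev (z * \<Psi>) \<phi> - ev (\<Psi> * z) \<phi>) \<le> 0 + r" if r: "0 < r" for r
    proof -
      \<comment> \<open>The added 1 keeps the divisor positive for \<Psi> = 0.\<close>
      have "0 < r / (2 * norm \<Psi> + 1)" using r by (simp add: add_nonneg_pos)
      from bound[OF this] have "cmod (ev (z * \<Psi>) \<phi> - ev (\<Psi> * z) \<phi>) \<le> r * ((2 * norm \<Psi>) / (2 * norm \<Psi> + 1))"
        by simp
      also have "\<dots> \<le> r * 1"
        using r by (intro mult_left_mono) (simp_all add: divide_le_eq add_nonneg_pos)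
      finally show ?thesis by simp
    qed
    then have "cmod (ev (z * \<Psi>) \<phi> - ev (\<Psi> * z) \<phi>) \<le> 0" by (rule field_le_epsilon)
    then show "ev (z * \<Psi>) \<phi> = ev (\<Psi> * z) \<phi>" by simp
  qed
  have lim_left: "((\<lambda>v. ev (v * \<Psi>) \<phi>) \<longlongrightarrow> ev (z * \<Psi>) \<phi>) F" if "\<phi> \<in> udual" for \<phi> \<Psi>
    using lim_right[OF that, of \<Psi>] by (simp add: zcomm)
  have upper: "u * z = u" if u: "u \<in> D" for u
  proof (rule bidual_eqI)
    fix \<phi> :: "'a dual_el" assume \<phi>: "\<phi> \<in> udual"
    have "eventually (\<lambda>v. ev (v * u) \<phi> = ev u \<phi>) F"
      unfolding evF using u Mcentral_comm[OF D[OF u]] by (intro bexI[of _ u]) auto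
    then have "((\<lambda>v. ev (v * u) \<phi>) \<longlongrightarrow> ev u \<phi>) F" by (rule tendsto_eventually)
    then show "ev (u * z) \<phi> = ev u \<phi>" using lim_right[OF \<phi>, of u] F tendsto_unique by blast
  qed
  have least: "z * y = z" if y: "\<And>u. u \<in> D \<Longrightarrow> u * y = u" for y
  proof (rule bidual_eqI)
    fix \<phi> :: "'a dual_el" assume \<phi>: "\<phi> \<in> udual"
    have "eventually (\<lambda>v. ev (v * y) \<phi> = ev v \<phi>) F" using in_D by eventually_elim (simp add: y)
    then have "((\<lambda>v. ev v \<phi>) \<longlongrightarrow> ev (z * y) \<phi>) F"
      by (rule Lim_transform_eventually[OF lim_left[OF \<phi>]])
    then show "ev (z * y) \<phi> = ev z \<phi>" using lim[OF \<phi>] F tendsto_unique unfolding evz by blast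
  qed
  have "Mcentral z"
    unfolding Mcentral_def
  proof (intro conjI allI zcomm)
    show "z * z = z" by (rule least[OF upper])
    fix x y
    show "norm (z * x + (y - z * y)) \<le> max (norm x) (norm y)"
    proof (rule bidual_norm_le)
      fix \<phi> :: "'a dual_el" assume \<phi>: "\<phi> \<in> udual"
      show "cmod (ev (z * x + (y - z * y)) \<phi>) \<le> max (norm x) (norm y) * dnorm \<phi>"
      proof (rule tendsto_upperbound[OF _ _ F])
        show "((\<lambda>v. cmod (ev (v * x + (y - v * y)) \<phi>)) \<longlongrightarrow> cmod (ev (z * x + (y - z * y)) \<phi>)) F"
          unfolding ev_add ev_diff badd_def bscale_def by (intro tendsto_intros lim_left \<phi>)
        show "\<forall>\<^sub>F v in F. cmod (ev (v * x + (y - v * y)) \<phi>) \<le> max (norm x) (norm y) * dnorm \<phi>"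
          using in_D
        proof eventually_elim
          case (elim v)
          show ?case
            using ev_norm_bound[OF \<phi>, of "v * x + (y - v * y)"]
              mult_right_mono[OF Mcentral_norm[OF D[OF elim], of x y] dnorm_nonneg[OF \<phi>]] by linarith
        qed
      qed
    qed (simp add: le_max_iff_disj)
  qed
  moreover have "ev (z * \<Psi>) \<phi> = 0" if "\<phi> \<in> udual" "\<forall>u\<in>D. \<forall>\<Psi>. ev (u * \<Psi>) \<phi> = 0" for \<phi> \<Psi>
  proof -
    have "eventually (\<lambda>v. ev (v * \<Psi>) \<phi> = 0) F" using in_D by eventually_elim (simp add: that)
    then have "((\<lambda>v. ev (v * \<Psi>) \<phi>) \<longlongrightarrow> 0) F" by (rule tendsto_eventually)
    then show ?thesis using lim_left[OF that(1)] F tendsto_unique by blast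
  qed
  ultimately show ?thesis using upper least by blast
qed

section \<open>Supports of M-ideal ideals\<close>

lemma ball_Nsp_iff: "(\<forall>\<Phi>\<in>Nsp. R \<Phi>) \<longleftrightarrow> (\<forall>\<Phi>. R (ev \<Phi>))"
  by (metis ev Bidual_inverse)

lemma range_ev: "range ev = Nsp"
  by (metis ev Bidual_inverse image_subsetI rangeI subsetI subset_antisym)

lemma oneN_eq: "oneN = ev (embed (0, 1))"
  by (simp add: oneN_def ev_embed_eq)

text \<open>This is \<open>J\<^sup>\<bottom>\<^sup>\<bottom>\<close> inside the type
  \<open>bidual\<close>; see \<open>perpperp_eq\<close>.\<close>

definition annih2 :: "'a::complex_banach_algebra set \<Rightarrow> 'a bidual set" where
  "annih2 J = {\<Phi>. \<forall>\<phi>\<in>perp (inA ` J). ev \<Phi> \<phi> = 0}"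

lemma perpperp_eq: "perpperp (inA ` J) = ev ` annih2 J"
  unfolding perpperp_def annih2_def using ev by (auto simp: image_iff) (metis Bidual_inverse)

lemma annih2_mono: "J \<subseteq> J' \<Longrightarrow> annih2 J \<subseteq> annih2 J'"
  unfolding annih2_def perp_def by blast

lemma annih2_Abidual: "\<Phi> \<in> annih2 J \<Longrightarrow> ev \<Phi> \<in> Abidual"
  unfolding Abidual_def perpperp_eq using annih2_mono[of J UNIV] by auto

lemma embed_annih2: "a \<in> J \<Longrightarrow> embed (inA a) \<in> annih2 J"
  by (auto simp: annih2_def perp_def ev_embed)

text \<open>A functional that annihilates \<open>A\<close> is determined by its value at 1, hence is
  a multiple of \<open>snd\<close>. This decomposition extends commutation with
  \<open>Abidual\<close> to the whole bidual.\<close>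

lemma bidual_eq_Abidual_plus_unit:
  "\<exists>\<Psi> c. ev \<Psi> \<in> Abidual \<and> \<Phi> = \<Psi> + scaleC c (embed (0, 1))"
proof -
  have mem: "ev \<Psi> \<in> Abidual" if "\<And>\<phi>. \<phi> \<in> perp (range inA) \<Longrightarrow> ev \<Psi> \<phi> = 0" for \<Psi> :: "'a bidual"
    using that by (simp add: Abidual_def perpperp_def ev)
  have \<phi>: "\<phi> \<in> udual" and \<phi>_eq: "\<phi> = (\<lambda>x. \<phi> (0, 1) * snd x)"
    if "\<phi> \<in> perp (range inA)" for \<phi> :: "'a dual_el"
  proof -
    show \<phi>: "\<phi> \<in> udual" using that by (simp add: perp_def)
    show "\<phi> = (\<lambda>x. \<phi> (0, 1) * snd x)"
    proof
      fix x :: "'a unit_el"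
      have "x = inA (fst x) + uscale (snd x) (0, 1)" by (simp add: inA_def uscale_def prod_eq_iff)
      then have "\<phi> x = \<phi> (inA (fst x)) + snd x * \<phi> (0, 1)"
        using udual_add[OF \<phi>] udual_uscale[OF \<phi>] by metis
      then show "\<phi> x = \<phi> (0, 1) * snd x" using that by (simp add: perp_def)
    qed
  qed
  show ?thesis
  proof (cases "(snd :: 'a dual_el) \<in> udual")
    case True
    define \<Psi> where "\<Psi> = \<Phi> - scaleC (ev \<Phi> snd) (embed (0, 1))"
    have "ev \<Psi> \<in> Abidual"
    proof (rule mem)
      fix \<psi> :: "'a dual_el" assume p: "\<psi> \<in> perp (range inA)"
      have "ev \<Phi> \<psi> = \<psi> (0, 1) * ev \<Phi> snd"
        by (subst \<phi>_eq[OF p]) (rule ev_times_right[OF True])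
      then show "ev \<Psi> \<psi> = 0"
        by (simp add: \<Psi>_def ev_diff ev_scaleC badd_def bscale_def ev_embed[OF \<phi>[OF p]])
    qed
    then show ?thesis
      by (intro exI[of _ \<Psi>] exI[of _ "ev \<Phi> snd"]) (simp add: \<Psi>_def)
  next
    \<comment> \<open>As for unital \<open>A\<close> with unit e, where (e, -1) has seminorm 0: only
      the zero functional annihilates \<open>A\<close>, so \<open>Abidual\<close> is
      everything.\<close>
    case False
    have "ev \<Phi> \<in> Abidual"
    proof (rule mem)
      fix \<psi> :: "'a dual_el" assume p: "\<psi> \<in> perp (range inA)"
      have "\<psi> (0, 1) = 0"
      proof (rule ccontr)
        assume n: "\<psi> (0, 1) \<noteq> 0"
        have "(\<lambda>x. (1 / \<psi> (0, 1)) * \<psi> x) \<in> udual" by (rule udual_times[OF \<phi>[OF p]])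
        moreover have "(\<lambda>x. (1 / \<psi> (0, 1)) * \<psi> x) = snd"
          by (subst (2) \<phi>_eq[OF p]) (use n in auto)
        ultimately show False using False by simp
      qed
      then have "\<psi> = (\<lambda>x. 0)" using \<phi>_eq[OF p] by simp
      then show "ev \<Phi> \<psi> = 0" using Nsp_null[OF ev] by simp
    qed
    then show ?thesis by (intro exI[of _ \<Phi>] exI[of _ 0]) simp
  qed
qed

lemma Mprojection_of_is_Mproj:
  assumes "is_Mproj P"
  shows "Mprojection (\<lambda>\<Phi>. Bidual (P (ev \<Phi>)))"
proof -
  have P: "\<And>\<Phi>. P (ev \<Phi>) \<in> Nsp"
    "\<And>\<Phi> \<Psi>. P (badd (ev \<Phi>) (ev \<Psi>)) = badd (P (ev \<Phi>)) (P (ev \<Psi>))"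
    "\<And>\<Phi> c. P (bscale c (ev \<Phi>)) = bscale c (P (ev \<Phi>))"
    "\<And>\<Phi>. P (P (ev \<Phi>)) = P (ev \<Phi>)"
    "\<And>\<Phi>. bnorm (ev \<Phi>) = max (bnorm (P (ev \<Phi>))) (bnorm (badd (ev \<Phi>) (bscale (-1) (P (ev \<Phi>)))))"
    using assms unfolding is_Mproj_def ball_Nsp_iff by blast+
  show ?thesis
    unfolding Mprojection_def clinear_op_def
  proof (intro conjI allI)
    fix \<Phi> \<Psi> and c :: complex
    show "Bidual (P (ev (\<Phi> + \<Psi>))) = Bidual (P (ev \<Phi>)) + Bidual (P (ev \<Psi>))"
      unfolding ev_add P(2) by (simp add: plus_bidual_def Bidual_inverse[OF P(1)])
    show "Bidual (P (ev (scaleC c \<Phi>))) = scaleC c (Bidual (P (ev \<Phi>)))"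
      unfolding ev_scaleC P(3) by (simp add: scaleC_bidual_def Bidual_inverse[OF P(1)])
    show "Bidual (P (ev (Bidual (P (ev \<Phi>))))) = Bidual (P (ev \<Phi>))"
      by (simp add: P(4) Bidual_inverse[OF P(1)])
    show "norm \<Phi> = max (norm (Bidual (P (ev \<Phi>)))) (norm (\<Phi> - Bidual (P (ev \<Phi>))))"
      unfolding norm_bidual_def ev_diff Bidual_inverse[OF P(1)] by (rule P(5))
  qed
qed

lemma Mcentral_is_Mproj:
  assumes "Mcentral z"
  shows "is_Mproj (arens2 (ev z))"
proof -
  have M: "Mprojection (\<lambda>\<Phi>. z * \<Phi>)" using assms by (rule Mcentral_Mprojection)
  show ?thesis
    unfolding is_Mproj_def ball_Nsp_iff
    unfolding ev_mult[symmetric] ev_add[symmetric] ev_scaleC[symmetric]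
    unfolding ev_mult[symmetric] ev_add[symmetric] ev_scaleC[symmetric] norm_bidual_def[symmetric]
  proof (intro conjI allI)
    fix \<Phi> \<Psi> :: "'a bidual" and c :: complex
    show "ev (z * \<Phi>) \<in> Nsp" by (rule ev)
    show "ev (z * (\<Phi> + \<Psi>)) = ev (z * \<Phi> + z * \<Psi>)" by (simp add: distrib_left)
    show "ev (z * scaleC c \<Phi>) = ev (scaleC c (z * \<Phi>))" by (simp add: scaleC_mult_right)
    show "ev (z * (z * \<Phi>)) = ev (z * \<Phi>)" by (simp add: Mprojection_idem[OF M])
    have "norm \<Phi> = max (norm (z * \<Phi>)) (norm (\<Phi> - z * \<Phi>))" by (rule Mprojection_norm[OF M])
    then show "norm \<Phi> = max (norm (z * \<Phi>)) (norm (\<Phi> + scaleC (-1) (z * \<Phi>)))"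
      by (simp add: scaleC_one)
  qed
qed

text \<open>The working form of "\<open>z\<close> is the support projection of \<open>J\<close>":
  for closed subspaces, having such a \<open>z\<close> is equivalent to \<open>is_MII\<close> by
  \<open>is_MII_supports\<close> and \<open>supports_is_MII\<close>.\<close>

definition supports :: "'a::complex_banach_algebra bidual \<Rightarrow> 'a set \<Rightarrow> bool" where
  "supports z J \<longleftrightarrow> Mcentral z \<and> range (\<lambda>\<Phi>. z * \<Phi>) = annih2 J"

lemma supports_Mcentral: "supports z J \<Longrightarrow> Mcentral z"
  by (simp add: supports_def)

lemma supports_annih2: "supports z J \<Longrightarrow> z * \<Phi> \<in> annih2 J"
  by (auto simp: supports_def)

lemma supports_annih2_iff:
  assumes "supports z J"
  shows "\<Phi> \<in> annih2 J \<longleftrightarrow> z * \<Phi> = \<Phi>"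
proof
  assume "\<Phi> \<in> annih2 J"
  then obtain \<Psi> where "\<Phi> = z * \<Psi>" using assms by (auto simp: supports_def)
  then show "z * \<Phi> = \<Phi>" by (simp add: Mcentral_idem[OF supports_Mcentral[OF assms]] flip: mult.assoc)
qed (metis supports_annih2[OF assms])

lemma supportsI:
  assumes "Mcentral z" "\<And>\<Phi>. z * \<Phi> \<in> annih2 J" "\<And>\<Phi>. \<Phi> \<in> annih2 J \<Longrightarrow> z * \<Phi> = \<Phi>"
  shows "supports z J"
  unfolding supports_def using assms by (metis image_subsetI rangeI subsetI subset_antisym)

lemma supports_self: "supports z J \<Longrightarrow> z \<in> annih2 J"
  using supports_annih2_iff Mcentral_idem[OF supports_Mcentral] by blast

lemma supports_image:
  assumes "supports z J"
  shows "arens2 (ev z) ` Nsp = perpperp (inA ` J)"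
proof -
  have "arens2 (ev z) ` Nsp = ev ` range (\<lambda>\<Phi>. z * \<Phi>)"
    by (simp add: image_image ev_mult flip: range_ev)
  then show ?thesis using assms by (simp add: perpperp_eq supports_def)
qed

lemma arens2_oneN: "arens2 (ev z) oneN = ev z"
  by (simp add: oneN_eq contractive_unit_mult[OF contractive_unit_embed] flip: ev_mult)

lemma is_MII_supports:
  assumes "is_MII J"
  shows "\<exists>z. supports z J"
proof -
  obtain P where P: "is_Mproj P" "P ` Nsp = perpperp (inA ` J)"
    and comm: "\<And>\<Phi>. \<Phi> \<in> Abidual \<Longrightarrow> arens2 (P oneN) \<Phi> = arens2 \<Phi> (P oneN)"
    using assms unfolding is_MII_def by blast
  define Q where "Q \<Phi> = Bidual (P (ev \<Phi>))" for \<Phi>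
  have Q: "Mprojection Q" unfolding Q_def by (rule Mprojection_of_is_Mproj[OF P(1)])
  have evQ: "ev (Q \<Phi>) = P (ev \<Phi>)" for \<Phi>
    using P(1) ev by (auto simp: Q_def is_Mproj_def intro!: Bidual_inverse)
  define e :: "'a bidual" where "e = embed (0, 1)"
  have e: "contractive_unit e" unfolding e_def by (rule contractive_unit_embed)
  have commA: "Q e * \<Psi> = \<Psi> * Q e" if "ev \<Psi> \<in> Abidual" for \<Psi>
    using comm[OF that] by (simp add: oneN_eq e_def[symmetric] ev_inject flip: evQ ev_mult)
  have comm: "Q e * \<Phi> = \<Phi> * Q e" for \<Phi>
  proof -
    obtain \<Psi> c where \<Psi>: "ev \<Psi> \<in> Abidual" "\<Phi> = \<Psi> + scaleC c e"
      using bidual_eq_Abidual_plus_unit[of \<Phi>] unfolding e_def by blast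
    then show ?thesis
      using commA[OF \<Psi>(1)] by (simp add: distrib_left distrib_right contractive_unit_mult[OF e]
          flip: scaleC_mult_left scaleC_mult_right)
  qed
  have "ev ` range Q = ev ` annih2 J"
    using P(2) by (simp add: perpperp_eq image_image evQ flip: range_ev)
  then have "range Q = annih2 J" by (simp add: inj_image_eq_iff inj_def ev_inject)
  moreover have "Q = (\<lambda>\<Phi>. Q e * \<Phi>)" using Mprojection_eq_mult[OF Q e comm] by blast
  ultimately have "range (\<lambda>\<Phi>. Q e * \<Phi>) = annih2 J" by metis
  then show ?thesis using Mprojection_Mcentral[OF Q e comm] by (auto simp: supports_def)
qed

lemma supports_is_MII:
  assumes "csubspace J" "closed J" and z: "supports z J"
  shows "is_MII J"
  unfolding is_MII_def
proof (intro conjI exI[of _ "arens2 (ev z)"] assms(1,2) Mcentral_is_Mproj supports_Mcentral[OF z]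
    supports_image[OF z] ballI)
  fix \<Phi> :: "'a bidual_el" assume "\<Phi> \<in> Abidual"
  then have "\<Phi> \<in> Nsp" by (simp add: Abidual_def perpperp_def)
  then obtain \<Psi> where \<Psi>: "\<Phi> = ev \<Psi>" using Bidual_inverse by metis
  have "z * \<Psi> = \<Psi> * z" by (rule Mcentral_comm[OF supports_Mcentral[OF z]])
  then show "arens2 (arens2 (ev z) oneN) \<Phi> = arens2 \<Phi> (arens2 (ev z) oneN)"
    unfolding arens2_oneN \<Psi> by (metis ev_mult)
qed

text \<open>Every M-projection competing in the definite description has the range of multiplication
  by \<open>z\<close>, hence equals it.\<close>

lemma supp_eq:
  assumes z: "supports z J"
  shows "supp J = ev z"
  unfolding supp_def
proof (rule the_equality)
  show "\<exists>P. is_Mproj P \<and> P ` Nsp = perpperp (inA ` J) \<and> ev z = P oneN"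
    using Mcentral_is_Mproj[OF supports_Mcentral[OF z]] supports_image[OF z] arens2_oneN by metis
next
  fix y assume "\<exists>P. is_Mproj P \<and> P ` Nsp = perpperp (inA ` J) \<and> y = P oneN"
  then obtain P where P: "is_Mproj P" "P ` Nsp = perpperp (inA ` J)" "y = P oneN" by blast
  define Q where "Q \<Phi> = Bidual (P (ev \<Phi>))" for \<Phi>
  have Q: "Mprojection Q" unfolding Q_def by (rule Mprojection_of_is_Mproj[OF P(1)])
  have evQ: "ev (Q \<Phi>) = P (ev \<Phi>)" for \<Phi>
    using P(1) ev by (auto simp: Q_def is_Mproj_def intro!: Bidual_inverse)
  have "ev ` range Q = ev ` annih2 J"
    using P(2) by (simp add: perpperp_eq image_image evQ flip: range_ev)
  then have "range Q = range (\<lambda>\<Phi>. z * \<Phi>)"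
    using z by (simp add: inj_image_eq_iff inj_def ev_inject supports_def)
  then have "Q = (\<lambda>\<Phi>. z * \<Phi>)"
    by (rule Mprojection_unique[OF Q Mcentral_Mprojection[OF supports_Mcentral[OF z]]])
  then have "Q (embed (0, 1)) = z" by (simp add: contractive_unit_mult[OF contractive_unit_embed])
  then show "y = ev z" using P(3) evQ[of "embed (0, 1)"] by (simp add: oneN_eq)
qed

text \<open>Multiplication by \<open>z\<close> is itself an M-projection, so one-term sums meet both
  approximation conditions with error zero.\<close>

lemma supports_Delta:
  assumes z: "supports z J"
  shows "ev z \<in> Delta'" "ev z \<in> Abidual" "is_proj (ev z)"
proof -
  let ?T = "arens2 (ev z)"
  have T: "is_Mproj ?T" by (rule Mcentral_is_Mproj[OF supports_Mcentral[OF z]])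
  show A: "ev z \<in> Abidual" using annih2_Abidual supports_self[OF z] .
  show p: "is_proj (ev z)"
    by (simp add: is_proj_def ev Mcentral_idem[OF supports_Mcentral[OF z]] flip: ev_mult)
  have S: "?T \<in> Mspan"
  proof -
    have "?T = (\<lambda>\<Phi> \<phi>. \<Sum>P\<in>{?T}. 1 * P \<Phi> \<phi>)" by simp
    then show ?thesis using T unfolding Mspan_def by (intro CollectI exI[of _ "{?T}"] exI[of _ "\<lambda>_. 1"]) auto
  qed
  have "?T \<in> centralizer"
    unfolding centralizer_def ball_Nsp_iff
  proof (intro CollectI conjI allI impI bexI[OF _ S])
    fix \<Phi> :: "'a bidual" and \<epsilon> :: real assume \<epsilon>: "0 < \<epsilon>"
    have "bnorm (badd (?T (ev \<Phi>)) (bscale (-1) (?T (ev \<Phi>)))) = norm (z * \<Phi> - z * \<Phi>)"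
      unfolding norm_bidual_def ev_diff ev_mult ..
    then show "bnorm (badd (?T (ev \<Phi>)) (bscale (-1) (?T (ev \<Phi>)))) \<le> \<epsilon> * bnorm (ev \<Phi>)"
      using \<epsilon> bnorm_nonneg[OF ev, of \<Phi>] by simp
  qed (simp add: arens2_Nsp ev)
  then have D: "ev z \<in> Delta" unfolding Delta_def using arens2_oneN by (metis image_eqI)
  have "ev z \<in> Nspan {p \<in> Delta. is_proj p \<and> p \<in> Abidual}"
    using D p A unfolding Nspan_def by (intro CollectI exI[of _ "{ev z}"] exI[of _ "\<lambda>_. 1"]) auto
  then show "ev z \<in> Delta'" unfolding Delta'_def wstar_closure_def using D by (force simp: ev)
qed

text \<open>Hahn--Banach in the form \<open>J = s\<^sub>J N \<inter> A\<close>: a point outside a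
  closed J is detected by a functional that annihilates J.\<close>

lemma supports_mem_iff:
  fixes J :: "'a::complex_banach_algebra set"
  assumes "approx_unital TYPE('a)" "csubspace J" "closed J" and z: "supports z J"
  shows "a \<in> J \<longleftrightarrow> z * embed (inA a) = embed (inA a)"
  unfolding supports_annih2_iff[OF z, symmetric]
proof
  assume a: "embed (inA a) \<in> annih2 J"
  show "a \<in> J"
  proof (rule ccontr)
    assume "a \<notin> J"
    then obtain \<phi> where "\<phi> \<in> udual" "\<forall>j\<in>J. \<phi> (inA j) = 0" "\<phi> (inA a) \<noteq> 0"
      using udual_separates[OF assms(1-3)] by blast
    with a show False by (auto simp: annih2_def perp_def ev_embed)
  qed
qed (rule embed_annih2)

text \<open>A central z fixes a product as soon as it fixes one of the factors.\<close>

lemma supports_ideal: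
  fixes J :: "'a::complex_banach_algebra set"
  assumes J: "approx_unital TYPE('a)" "csubspace J" "closed J" and z: "supports z J" and a: "a \<in> J"
  shows "a * b \<in> J" "b * a \<in> J"
proof -
  note c = Mcentral_comm[OF supports_Mcentral[OF z]] and m = supports_mem_iff[OF J z]
  have za: "z * embed (inA a) = embed (inA a)" using a m by blast
  have "z * (embed (inA a) * embed (inA b)) = embed (inA a) * embed (inA b)"
    using za by (metis mult.assoc)
  then show "a * b \<in> J" unfolding m by (simp add: inA_mult embed_mult)
  have "z * (embed (inA b) * embed (inA a)) = embed (inA b) * embed (inA a)"
    using za c by (metis mult.assoc)
  then show "b * a \<in> J" unfolding m by (simp add: inA_mult embed_mult)
qed

text \<open>Forward, \<open>z1\<close> itself lies in \<open>annih2 J1\<close> and so in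
  \<open>annih2 J2\<close>; backward, membership in J1 and J2 is tested by multiplication.\<close>

lemma supports_subset_iff:
  fixes J1 J2 :: "'a::complex_banach_algebra set"
  assumes au: "approx_unital TYPE('a)" and J1: "csubspace J1" "closed J1" "supports z1 J1"
    and J2: "csubspace J2" "closed J2" "supports z2 J2"
  shows "J1 \<subseteq> J2 \<longleftrightarrow> z2 * z1 = z1"
proof
  assume "J1 \<subseteq> J2"
  then have "z1 \<in> annih2 J2" using annih2_mono supports_self[OF J1(3)] by blast
  then show "z2 * z1 = z1" using supports_annih2_iff[OF J2(3)] by blast
next
  assume z: "z2 * z1 = z1"
  show "J1 \<subseteq> J2"
  proof
    fix a assume "a \<in> J1"
    then have "z1 * embed (inA a) = embed (inA a)" using supports_mem_iff[OF au J1] by blast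
    then have "z2 * embed (inA a) = embed (inA a)" using z by (metis mult.assoc)
    then show "a \<in> J2" using supports_mem_iff[OF au J2] by blast
  qed
qed

lemma supports_proj_le_iff:
  assumes "supports z1 J1" "supports z2 J2"
  shows "proj_le (ev z1) (ev z2) \<longleftrightarrow> z2 * z1 = z1"
  using Mcentral_comm[OF supports_Mcentral[OF assms(2)], of z1]
  by (auto simp: proj_le_def ev_inject simp flip: ev_mult)

text \<open>For the inclusion of \<open>z1 z2 N\<close> in the second annihilator, the product is
  written with \<open>z2\<close> rightmost and the Arens definition is unwound one factor at a
  time.\<close>

lemma supports_Int:
  fixes J1 J2 :: "'a::complex_banach_algebra set"
  assumes au: "approx_unital TYPE('a)" and J1: "csubspace J1" "closed J1" "supports z1 J1"
    and J2: "csubspace J2" "closed J2" "supports z2 J2"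
  shows "supports (z1 * z2) (J1 \<inter> J2)"
proof (rule supportsI)
  note c1 = supports_Mcentral[OF J1(3)] and c2 = supports_Mcentral[OF J2(3)]
  show "Mcentral (z1 * z2)" by (rule Mcentral_mult[OF c1 c2])
  fix \<Phi> :: "'a bidual"
  show "z1 * z2 * \<Phi> \<in> annih2 (J1 \<inter> J2)"
    unfolding annih2_def
  proof (intro CollectI ballI)
    fix \<phi> :: "'a dual_el" assume p: "\<phi> \<in> perp (inA ` (J1 \<inter> J2))"
    then have \<phi>: "\<phi> \<in> udual" by (simp add: perp_def)
    \<comment> \<open>For fixed a in J2 the functional y -> \<phi>(ya) kills J1, because products ba
      with b in J1 lie in both ideals.\<close>
    have "ev (\<Phi> * z1) (\<lambda>y. \<phi> (umult y (inA a))) = 0" if a: "a \<in> J2" for a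
    proof -
      have "b * a \<in> J1 \<inter> J2" if "b \<in> J1" for b
        using supports_ideal(1)[OF au J1 that] supports_ideal(2)[OF au J2 a] by blast
      then have "(\<lambda>y. \<phi> (umult y (inA a))) \<in> perp (inA ` J1)"
        using p by (auto simp: perp_def udual_shift simp flip: inA_mult)
      moreover have "\<Phi> * z1 \<in> annih2 J1"
        using supports_annih2[OF J1(3), of \<Phi>] Mcentral_comm[OF c1, of \<Phi>] by simp
      ultimately show ?thesis by (simp add: annih2_def)
    qed
    \<comment> \<open>So \<phi>.(\<Phi> z1) kills J2, and evaluating \<open>z2\<close> at it gives
      0.\<close>
    then have "(\<lambda>x. ev (\<Phi> * z1) (\<lambda>y. \<phi> (umult y x))) \<in> perp (inA ` J2)"
      using ev_functional[OF \<phi>] by (auto simp: perp_def)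
    then have "ev (\<Phi> * z1 * z2) \<phi> = 0"
      using supports_self[OF J2(3)] by (simp add: ev_mult_apply[OF \<phi>] annih2_def)
    moreover have "z1 * z2 * \<Phi> = \<Phi> * z1 * z2"
      using Mcentral_comm[OF Mcentral_mult[OF c1 c2], of \<Phi>] by (simp add: mult.assoc)
    ultimately show "ev (z1 * z2 * \<Phi>) \<phi> = 0" by simp
  qed
  assume "\<Phi> \<in> annih2 (J1 \<inter> J2)"
  then have "\<Phi> \<in> annih2 J1" "\<Phi> \<in> annih2 J2" using annih2_mono by blast+
  then have "z1 * \<Phi> = \<Phi>" "z2 * \<Phi> = \<Phi>" using supports_annih2_iff J1(3) J2(3) by blast+
  then show "z1 * z2 * \<Phi> = \<Phi>" by (simp add: mult.assoc)
qed

section \<open>Closed spans\<close>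

lemma csubspace_cspan: "csubspace (cspan S)"
  unfolding csubspace_def
proof (intro conjI ballI allI)
  show "0 \<in> cspan S" unfolding cspan_def by (intro CollectI exI[of _ "{}"]) auto
next
  fix x y assume "x \<in> cspan S" "y \<in> cspan S"
  then obtain F c G d where x: "x = (\<Sum>v\<in>F. scaleC (c v) v)" "finite F" "F \<subseteq> S"
    and y: "y = (\<Sum>v\<in>G. scaleC (d v) v)" "finite G" "G \<subseteq> S"
    unfolding cspan_def by auto
  \<comment> \<open>Both coefficient families are extended by 0 to the union of their index
    sets.\<close>
  define k where "k v = (if v \<in> F then c v else 0) + (if v \<in> G then d v else 0)" for v
  have "x = (\<Sum>v\<in>F \<union> G. scaleC (if v \<in> F then c v else 0) v)"
    unfolding x(1) by (rule sum.mono_neutral_cong_left) (use x y in auto)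
  moreover have "y = (\<Sum>v\<in>F \<union> G. scaleC (if v \<in> G then d v else 0) v)"
    unfolding y(1) by (rule sum.mono_neutral_cong_left) (use x y in auto)
  ultimately have "x + y = (\<Sum>v\<in>F \<union> G. scaleC (k v) v)"
    by (simp add: k_def scaleC_add_left flip: sum.distrib)
  then show "x + y \<in> cspan S"
    unfolding cspan_def using x y by (intro CollectI exI[of _ "F \<union> G"] exI[of _ k]) auto
next
  fix a x assume "x \<in> cspan S"
  then obtain F c where x: "x = (\<Sum>v\<in>F. scaleC (c v) v)" "finite F" "F \<subseteq> S"
    unfolding cspan_def by auto
  have "scaleC a (\<Sum>v\<in>F. scaleC (c v) v) = (\<Sum>v\<in>F. scaleC (a * c v) v)"
    using x(2) by (induction F rule: finite_induct) (simp_all add: scaleC_add_right scaleC_scaleC)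
  then show "scaleC a x \<in> cspan S"
    unfolding cspan_def x(1) using x by (intro CollectI exI[of _ F] exI[of _ "\<lambda>v. a * c v"]) auto
qed

lemma cspan_superset: "S \<subseteq> cspan S"
proof
  fix x assume "x \<in> S"
  then show "x \<in> cspan S"
    unfolding cspan_def by (intro CollectI exI[of _ "{x}"] exI[of _ "\<lambda>_. 1"]) (auto simp: scaleC_one)
qed

lemma bounded_linear_scaleC: "bounded_linear (scaleC c)"
proof (rule bounded_linear_intro)
  show "scaleC c (r *\<^sub>R x) = r *\<^sub>R scaleC c x" for r and x :: 'a
    by (simp add: scaleC_scaleC mult.commute flip: scaleC_of_real)
  show "norm (scaleC c x) \<le> norm x * cmod c" for x :: 'a
    by (simp add: norm_scaleC mult.commute)
qed (rule scaleC_add_right)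

lemma csubspace_closure:
  assumes "csubspace S"
  shows "csubspace (closure S)"
  unfolding csubspace_def
proof (intro conjI ballI allI)
  show "0 \<in> closure S" using assms closure_subset by (auto simp: csubspace_def)
next
  fix x y assume "x \<in> closure S" "y \<in> closure S"
  then obtain f g where "\<And>n. f n \<in> S" "f \<longlonglongrightarrow> x" "\<And>n. g n \<in> S" "g \<longlonglongrightarrow> y"
    unfolding closure_sequential by blast
  then have "\<And>n. f n + g n \<in> S" "(\<lambda>n. f n + g n) \<longlonglongrightarrow> x + y"
    using assms by (auto simp: csubspace_def intro: tendsto_add)
  then show "x + y \<in> closure S"
    unfolding closure_sequential by (intro exI[of _ "\<lambda>n. f n + g n"]) blast
next
  fix c x assume "x \<in> closure S"
  then obtain f where "\<And>n. f n \<in> S" "f \<longlonglongrightarrow> x"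
    unfolding closure_sequential by blast
  then have "\<And>n. scaleC c (f n) \<in> S" "(\<lambda>n. scaleC c (f n)) \<longlonglongrightarrow> scaleC c x"
    using assms bounded_linear.tendsto[OF bounded_linear_scaleC] by (auto simp: csubspace_def)
  then show "scaleC c x \<in> closure S"
    unfolding closure_sequential by (intro exI[of _ "\<lambda>n. scaleC c (f n)"]) blast
qed

text \<open>Elements of \<open>udual\<close> are norm-continuous on \<open>A\<close>, so their
  kernels contain closed spans.\<close>

lemma perp_closure_cspan: "perp (inA ` closure (cspan S)) = perp (inA ` S)"
proof
  show "perp (inA ` closure (cspan S)) \<subseteq> perp (inA ` S)"
    unfolding perp_def using cspan_superset closure_subset by blast
  show "perp (inA ` S) \<subseteq> perp (inA ` closure (cspan S))"
  proof
    fix \<phi> assume "\<phi> \<in> perp (inA ` S)"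
    then have \<phi>: "\<phi> \<in> udual" and zero: "\<And>s. s \<in> S \<Longrightarrow> \<phi> (inA s) = 0" by (auto simp: perp_def)
    have bl: "bounded_linear (\<lambda>a. \<phi> (inA a))"
    proof (rule bounded_linear_intro)
      fix a b and r :: real
      show "\<phi> (inA (a + b)) = \<phi> (inA a) + \<phi> (inA b)" by (simp add: inA_add udual_add[OF \<phi>])
      show "\<phi> (inA (r *\<^sub>R a)) = r *\<^sub>R \<phi> (inA a)"
        by (simp add: inA_scaleC udual_uscale[OF \<phi>] scaleR_conv_of_real flip: scaleC_of_real)
      have "cmod (\<phi> (inA a)) \<le> dnorm \<phi> * unorm (inA a)" by (rule dnorm_bound[OF \<phi>])
      also have "\<dots> \<le> dnorm \<phi> * norm a" by (intro mult_left_mono unorm_inA_le dnorm_nonneg \<phi>)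
      finally show "cmod (\<phi> (inA a)) \<le> norm a * dnorm \<phi>" by (simp add: mult.commute)
    qed
    have "\<phi> (inA a) = 0" if mem: "a \<in> cspan S" for a
    proof -
      obtain F c where a: "a = (\<Sum>x\<in>F. scaleC (c x) x)" "finite F" "F \<subseteq> S"
        using mem unfolding cspan_def by auto
      have "\<phi> (inA a) = (\<Sum>x\<in>F. \<phi> (inA (scaleC (c x) x)))"
        unfolding a(1) by (rule linear_sum[OF bounded_linear.linear[OF bl]])
      also have "\<dots> = 0"
        using a(3) by (intro sum.neutral) (auto simp: inA_scaleC udual_uscale[OF \<phi>] zero)
      finally show ?thesis .
    qed
    moreover have "closed {a. \<phi> (inA a) = 0}"
      by (intro closed_Collect_eq continuous_on_const linear_continuous_on bl)
    ultimately have "closure (cspan S) \<subseteq> {a. \<phi> (inA a) = 0}" by (intro closure_minimal) auto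
    then show "\<phi> \<in> perp (inA ` closure (cspan S))" using \<phi> by (auto simp: perp_def)
  qed
qed

text \<open>Closing under binary joins makes the family directed. Including 0 keeps it nonempty for
  an empty \<open>S\<close>, whose closed span {0} has support 0.\<close>

inductive_set join_hull :: "'v::complex_banach_algebra set \<Rightarrow> 'v set" for S where
  zero: "0 \<in> join_hull S"
| base: "s \<in> S \<Longrightarrow> s \<in> join_hull S"
| join: "u \<in> join_hull S \<Longrightarrow> v \<in> join_hull S \<Longrightarrow> proj_join u v \<in> join_hull S"

text \<open>The support is the directed supremum of finite joins. A functional annihilating all
  \<open>K i\<close> is killed by each join and hence by the limit; absorption by an upper bound
  likewise extends from the \<open>z i\<close> to joins and then to \<open>s\<close>.\<close>

lemma supports_closed_span:
  fixes K :: "'i \<Rightarrow> 'a::complex_banach_algebra set"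
  assumes z: "\<And>i. i \<in> I \<Longrightarrow> supports (z i) (K i)"
  shows "\<exists>s. supports s (closure (cspan (\<Union>i\<in>I. K i))) \<and> (\<forall>i\<in>I. z i * s = z i) \<and>
    (\<forall>y. (\<forall>i\<in>I. z i * y = z i) \<longrightarrow> s * y = s)"
proof -
  define D where "D = join_hull (z ` I)"
  have D: "Mcentral u" if "u \<in> D" for u
    using that unfolding D_def
    by induction (use z in \<open>auto intro: Mcentral_zero Mcentral_join supports_Mcentral\<close>)
  have ne: "D \<noteq> {}" using join_hull.zero D_def by blast
  have dir: "\<exists>w\<in>D. u * w = u \<and> v * w = v" if "u \<in> D" "v \<in> D" for u v
    using that proj_join_upper[OF D D] join_hull.join unfolding D_def by blast
  obtain s where Sup: "Mcentral s \<and> (\<forall>u\<in>D. u * s = u) \<and> (\<forall>y. (\<forall>u\<in>D. u * y = u) \<longrightarrow> s * y = s) \<and>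
    (\<forall>\<phi>\<in>udual. (\<forall>u\<in>D. \<forall>\<Psi>. ev (u * \<Psi>) \<phi> = 0) \<longrightarrow> (\<forall>\<Psi>. ev (s * \<Psi>) \<phi> = 0))"
    by (rule exE[OF Mcentral_directed_Sup[OF ne D dir]])
  then have s: "Mcentral s" "\<And>u. u \<in> D \<Longrightarrow> u * s = u" by blast+
  have least: "s * y = s" if "\<And>u. u \<in> D \<Longrightarrow> u * y = u" for y
    using Sup that by simp
  have null: "ev (s * \<Psi>) \<phi> = 0" if "\<phi> \<in> udual" "\<And>u \<Psi>. u \<in> D \<Longrightarrow> ev (u * \<Psi>) \<phi> = 0" for \<phi> \<Psi>
    using Sup that by simp
  have zs: "z i * s = z i" if "i \<in> I" for i
    using s(2) that join_hull.base unfolding D_def by blast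
  define J where "J = closure (cspan (\<Union>i\<in>I. K i))"
  have perpJ: "perp (inA ` J) = perp (inA ` (\<Union>i\<in>I. K i))"
    unfolding J_def by (rule perp_closure_cspan)
  have "supports s J"
  proof (rule supportsI[OF s(1)])
    fix \<Phi> :: "'a bidual"
    show "s * \<Phi> \<in> annih2 J"
      unfolding annih2_def
    proof (intro CollectI ballI)
      fix \<phi> :: "'a dual_el" assume "\<phi> \<in> perp (inA ` J)"
      then have \<phi>: "\<phi> \<in> udual" "\<And>i. i \<in> I \<Longrightarrow> \<phi> \<in> perp (inA ` K i)"
        unfolding perpJ by (auto simp: perp_def)
      \<comment> \<open>\<Psi> has to vary in the induction: for a join, the hypothesis on u is used
        at v \<Psi>.\<close>
      have "ev (u * \<Psi>) \<phi> = 0" if "u \<in> D" for u \<Psi>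
        using that unfolding D_def
      proof (induction arbitrary: \<Psi>)
        case (base u)
        then show ?case using supports_annih2[OF z, of _ \<Psi>] \<phi>(2) by (auto simp: annih2_def)
      next
        case (join u v)
        have "proj_join u v * \<Psi> = u * \<Psi> + v * \<Psi> - u * (v * \<Psi>)"
          by (simp add: proj_join_def algebra_simps)
        then show ?case using join.IH by (simp add: ev_add ev_diff badd_def bscale_def)
      qed (simp add: ev_zero)
      then show "ev (s * \<Phi>) \<phi> = 0" by (rule null[OF \<phi>(1)])
    qed
    assume \<Phi>: "\<Phi> \<in> annih2 J"
    show "s * \<Phi> = \<Phi>"
    proof (rule bidual_eqI)
      fix \<phi> :: "'a dual_el" assume \<phi>: "\<phi> \<in> udual"
      \<comment> \<open>This is \<phi>.s. Since s fixes every element of each \<open>K i\<close>,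
        \<phi> - \<phi>.s annihilates J, so \<Phi> takes the same value at both, and \<Phi> at
        \<phi>.s is s \<Phi> at \<phi>.\<close>
      let ?\<chi> = "\<lambda>x. ev s (\<lambda>y. \<phi> (umult y x))"
      have "\<phi> (inA a) - ?\<chi> (inA a) = 0" if i: "i \<in> I" "a \<in> K i" for i a
      proof -
        have "z i * embed (inA a) = embed (inA a)"
          using supports_annih2_iff[OF z[OF i(1)]] embed_annih2[OF i(2)] by blast
        moreover have "s * z i = z i" using zs[OF i(1)] Mcentral_comm[OF s(1), of "z i"] by simp
        ultimately have "s * embed (inA a) = embed (inA a)" by (metis mult.assoc)
        then show ?thesis using ev_mult_embed[OF \<phi>, of s "inA a"] by (simp add: ev_embed[OF \<phi>])
      qed
      then have "(\<lambda>x. \<phi> x - ?\<chi> x) \<in> perp (inA ` J)"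
        unfolding perpJ using udual_minus[OF \<phi> ev_functional[OF \<phi>]] by (auto simp: perp_def)
      then have "ev \<Phi> (\<lambda>x. \<phi> x - ?\<chi> x) = 0" using \<Phi> by (simp add: annih2_def)
      then show "ev (s * \<Phi>) \<phi> = ev \<Phi> \<phi>"
        by (simp add: ev_mult_apply[OF \<phi>] ev_minus_right[OF \<phi> ev_functional[OF \<phi>]])
    qed
  qed
  moreover have "s * y = s" if y: "\<forall>i\<in>I. z i * y = z i" for y
  proof (rule least)
    fix u assume "u \<in> D"
    then show "u * y = u"
      unfolding D_def
    proof induction
      case (join u v)
      then show ?case by (simp add: proj_join_def distrib_right left_diff_distrib mult.assoc)
    qed (use y in auto)
  qed
  ultimately show ?thesis using zs unfolding J_def by blast
qed

section \<open>The lattice of M-ideal ideals\<close>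

lemma is_MII_D: "is_MII J \<Longrightarrow> csubspace J" "is_MII J \<Longrightarrow> closed J"
  by (simp_all add: is_MII_def)

lemma is_MII_Int:
  fixes J1 J2 :: "'a::complex_banach_algebra set"
  assumes au: "approx_unital TYPE('a)" and J1: "is_MII J1" and J2: "is_MII J2"
  shows "is_MII (J1 \<inter> J2)" "supp (J1 \<inter> J2) = arens2 (supp J1) (supp J2)"
proof -
  obtain z1 z2 where z: "supports z1 J1" "supports z2 J2" using is_MII_supports J1 J2 by metis
  have s: "supports (z1 * z2) (J1 \<inter> J2)"
    using supports_Int[OF au is_MII_D[OF J1] z(1) is_MII_D[OF J2] z(2)] .
  moreover have "csubspace (J1 \<inter> J2)"
    using is_MII_D(1)[OF J1] is_MII_D(1)[OF J2] by (simp add: csubspace_def)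
  ultimately show "is_MII (J1 \<inter> J2)"
    using is_MII_D(2)[OF J1] is_MII_D(2)[OF J2] by (intro supports_is_MII) auto
  show "supp (J1 \<inter> J2) = arens2 (supp J1) (supp J2)"
    by (simp add: supp_eq[OF s] supp_eq[OF z(1)] supp_eq[OF z(2)] ev_mult)
qed

lemma is_MII_INT:
  fixes L :: "'j \<Rightarrow> 'a::complex_banach_algebra set"
  assumes au: "approx_unital TYPE('a)" and "finite IF" "IF \<noteq> {}" "\<forall>i\<in>IF. is_MII (L i)"
  shows "is_MII (\<Inter>i\<in>IF. L i)"
  using assms(2-4) by (induction IF rule: finite_ne_induct) (auto intro: is_MII_Int(1)[OF au])

lemma supp_subset_iff:
  fixes J1 J2 :: "'a::complex_banach_algebra set"
  assumes au: "approx_unital TYPE('a)" and J1: "is_MII J1" and J2: "is_MII J2"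
  shows "J1 \<subseteq> J2 \<longleftrightarrow> proj_le (supp J1) (supp J2)"
proof -
  obtain z1 z2 where z: "supports z1 J1" "supports z2 J2" using is_MII_supports J1 J2 by metis
  show ?thesis
    unfolding supp_eq[OF z(1)] supp_eq[OF z(2)] supports_proj_le_iff[OF z]
    by (rule supports_subset_iff[OF au is_MII_D[OF J1] z(1) is_MII_D[OF J2] z(2)])
qed

lemma supp_properties:
  assumes "is_MII J"
  shows "supp J \<in> Delta'" "supp J \<in> Abidual" "is_proj (supp J)"
  using is_MII_supports[OF assms] supports_Delta supp_eq by metis+

lemma supp_inject:
  fixes J1 J2 :: "'a::complex_banach_algebra set"
  assumes au: "approx_unital TYPE('a)" and J1: "is_MII J1" and J2: "is_MII J2" and eq: "supp J1 = supp J2"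
  shows "J1 = J2"
proof -
  have "proj_le (supp J2) (supp J2)"
    using supp_properties(3)[OF J2] by (simp add: proj_le_def is_proj_def)
  then have "J1 \<subseteq> J2" "J2 \<subseteq> J1"
    using supp_subset_iff[OF au J1 J2] supp_subset_iff[OF au J2 J1] eq by simp_all
  then show ?thesis by blast
qed

lemma is_MII_closed_span:
  fixes K :: "'i \<Rightarrow> 'a::complex_banach_algebra set"
  assumes K: "\<forall>i\<in>I. is_MII (K i)"
  shows "is_MII (closure (cspan (\<Union>i\<in>I. K i)))"
    and "is_proj_sup Delta' ((\<lambda>i. supp (K i)) ` I) (supp (closure (cspan (\<Union>i\<in>I. K i))))"
proof -
  define J where "J = closure (cspan (\<Union>i\<in>I. K i))"
  have "\<forall>i\<in>I. \<exists>z. supports z (K i)" using K is_MII_supports by blast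
  then obtain z where z: "\<And>i. i \<in> I \<Longrightarrow> supports (z i) (K i)" by metis
  obtain s where Sup: "supports s J \<and> (\<forall>i\<in>I. z i * s = z i) \<and> (\<forall>y. (\<forall>i\<in>I. z i * y = z i) \<longrightarrow> s * y = s)"
    unfolding J_def by (rule exE[OF supports_closed_span[OF z]])
  then have s: "supports s J" "\<And>i. i \<in> I \<Longrightarrow> z i * s = z i" by blast+
  have least: "s * y = s" if "\<And>i. i \<in> I \<Longrightarrow> z i * y = z i" for y
    using Sup that by simp
  show M: "is_MII J"
    using supports_is_MII[OF _ _ s(1)] csubspace_closure[OF csubspace_cspan] unfolding J_def by blast
  have c: "Mcentral s" by (rule supports_Mcentral[OF s(1)])
  have le: "proj_le (supp (K i)) (supp J)" if "i \<in> I" for i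
    unfolding supp_eq[OF z[OF that]] supp_eq[OF s(1)] supports_proj_le_iff[OF z[OF that] s(1)]
    using s(2)[OF that] Mcentral_comm[OF c, of "z i"] by simp
  \<comment> \<open>A projection above all supports absorbs every \<open>z i\<close>, hence absorbs
    \<open>s\<close>; centrality of \<open>s\<close> gives the product in the other order.\<close>
  have "proj_le (supp J) q" if q: "is_proj q" "\<forall>i\<in>I. proj_le (supp (K i)) q" for q
  proof -
    obtain y where y: "q = ev y" using q(1) Bidual_inverse unfolding is_proj_def by metis
    have "z i * y = z i" if "i \<in> I" for i
    proof -
      have "arens2 (ev (z i)) (ev y) = ev (z i)"
        using q(2) that by (auto simp: proj_le_def supp_eq[OF z] y)
      then show ?thesis by (simp add: ev_inject flip: ev_mult)
    qed
    then have "s * y = s" by (rule least)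
    moreover have "y * s = s" using Mcentral_comm[OF c, of y] \<open>s * y = s\<close> by simp
    ultimately show ?thesis by (simp add: proj_le_def supp_eq[OF s(1)] y flip: ev_mult)
  qed
  then show "is_proj_sup Delta' ((\<lambda>i. supp (K i)) ` I) (supp J)"
    using le supp_properties[OF M] unfolding is_proj_sup_def by blast
qed

theorem theorem8p3:
  fixes J1 J2 :: "'a::complex_banach_algebra set"
    and L :: "'j \<Rightarrow> 'a set" and IF :: "'j set"
    and K :: "'i \<Rightarrow> 'a set" and I :: "'i set"
  assumes "approx_unital TYPE('a)"
  shows "(finite IF \<and> IF \<noteq> {} \<and> (\<forall>i\<in>IF. is_MII (L i)) \<longrightarrow> is_MII (\<Inter>i\<in>IF. L i))
    \<and> ((\<forall>i\<in>I. is_MII (K i)) \<longrightarrow> is_MII (closure (cspan (\<Union>i\<in>I. K i))))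
    \<and> (is_MII J1 \<longrightarrow> supp J1 \<in> Delta' \<and> supp J1 \<in> Abidual \<and> is_proj (supp J1))
    \<and> (is_MII J1 \<and> is_MII J2 \<longrightarrow> supp J1 = supp J2 \<longrightarrow> J1 = J2)
    \<and> (is_MII J1 \<and> is_MII J2 \<longrightarrow> (J1 \<subseteq> J2 \<longleftrightarrow> proj_le (supp J1) (supp J2)))
    \<and> (is_MII J1 \<and> is_MII J2 \<longrightarrow> supp (J1 \<inter> J2) = arens2 (supp J1) (supp J2))
    \<and> ((\<forall>i\<in>I. is_MII (K i)) \<longrightarrow>
         is_proj_sup Delta' ((\<lambda>i. supp (K i)) ` I) (supp (closure (cspan (\<Union>i\<in>I. K i)))))"
proof (intro conjI impI)
  show "is_MII (\<Inter>i\<in>IF. L i)" if "finite IF \<and> IF \<noteq> {} \<and> (\<forall>i\<in>IF. is_MII (L i))"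
    using is_MII_INT[OF assms] that by blast
  show "J1 = J2" if "is_MII J1 \<and> is_MII J2" "supp J1 = supp J2"
    using supp_inject[OF assms] that by blast
  show "J1 \<subseteq> J2 \<longleftrightarrow> proj_le (supp J1) (supp J2)" if "is_MII J1 \<and> is_MII J2"
    using supp_subset_iff[OF assms] that by blast
  show "supp (J1 \<inter> J2) = arens2 (supp J1) (supp J2)" if "is_MII J1 \<and> is_MII J2"
    using is_MII_Int(2)[OF assms] that by blast
qed (simp_all add: is_MII_closed_span supp_properties)

end
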